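(* Let $s\in(0,1)$, $N\ge2$, $K\ge1$ and $\sigma\equiv0$. Then there exists $a_0\in(0,1)$ such that the following holds for the particle system described in the context, with initial points $x_1^0<\dots<x_N^0$ and orientations $\zeta_1,\dots,\zeta_N\in\{-1,1\}$, exactly $K$ of which equal $-1$. With $\theta_j(t):=x_{j+1}(t)-x_j(t)$ and $\theta_j^0:=x_{j+1}^0-x_j^0>0$ for $j=1,\dots,N-1$, if for some $i\in\{1,\dots,N-1\}$ $$\zeta_i\zeta_{i+1}=-1\qquad\text{and}\qquad \theta_i^0\le a_0\min_{j\ne i}\theta_j^0,$$ then $$\theta_i(t)\le a_0\min_{j\ne i}\theta_j(t)\qquad\text{for any }t\in(0,T_c).$$ Moreover $\theta_i$ goes to zero in a finite time $T_c$ (the collision time of the system), with $$T_c\le\frac{s\,(\theta_i^0)^{2s+1}}{(2s+1)\gamma\,[1-(N-2)a_0^{2s}]}.$$ Here minima over $j\neq i$ are over $j\in\{1,\dots,N-1\}\setminus\{i\}$, with the minimum over the empty set (case $N=2$) equal to $+\infty$.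
   Context: Operator: for $s\in(0,1)$ and $\varphi\in C^2(\mathbb R)\cap L^\infty(\mathbb R)$, $\mathcal I_s[\varphi](x):=PV\int_{\mathbb R}\frac{\varphi(x+y)-\varphi(x)}{|y|^{1+2s}}\,dy$. $W$ satisfies: $W\in C^{3,\alpha}(\mathbb R)$ for some $0<\alpha<1$; $W(v+1)=W(v)$ for all $v\in\mathbb R$; $W=0$ on $\mathbb Z$; $W>0$ on $\mathbb R\setminus\mathbb Z$; $W''(0)>0$. Layer solution: $u$ is the unique solution of $\mathcal I_s(u)=W'(u)$ in $\mathbb R$, $u'>0$ in $\mathbb R$, $\lim_{x\to-\infty}u(x)=0$, $\lim_{x\to+\infty}u(x)=1$, $u(0)=\tfrac12$ (its existence and uniqueness are known). Set $\gamma:=\left(\int_{\mathbb R}(u'(x))^2dx\right)^{-1}>0$. Particle system (with $\sigma\equiv0$): $(x_i(t))_{i=1,\dots,N}$ solves $$\dot x_i=\gamma\sum_{j\ne i}\zeta_i\zeta_j\frac{x_i-x_j}{2s|x_i-x_j|^{1+2s}}\ \text{ in }(0,T_c),\qquad x_i(0)=x_i^0,$$ where $(0,T_c)$, $0<T_c\le+\infty$, is the maximal interval on which the system is well defined, i.e. on which $x_i\ne x_j$ for all $i\ne j$; thus $T_c$ is the first collision time. *)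

theory Defs
  imports "HOL-Analysis.Analysis"
begin

definition Ck :: "nat \<Rightarrow> (real \<Rightarrow> real) \<Rightarrow> bool" where
  "Ck k f \<longleftrightarrow>
     (\<forall>n<k. \<forall>x. (deriv ^^ n) f field_differentiable (at x)) \<and>
     continuous_on UNIV ((deriv ^^ k) f)"

text \<open>As usual, the derivatives up to order \<open>k\<close> of a function of class
  \<open>C\<^bsup>k,\<alpha>\<^esup>(\<real>)\<close> are bounded (for periodic functions this is automatic).\<close>

definition Ck_holder :: "nat \<Rightarrow> real \<Rightarrow> (real \<Rightarrow> real) \<Rightarrow> bool" where
  "Ck_holder k \<alpha> f \<longleftrightarrow>
     Ck k f \<and>
     (\<forall>n\<le>k. bounded (range ((deriv ^^ n) f))) \<and>
     (\<exists>C. \<forall>x y. \<bar>(deriv ^^ k) f x - (deriv ^^ k) f y\<bar> \<le> C * \<bar>x - y\<bar> powr \<alpha>)"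

definition multiwell_potential :: "(real \<Rightarrow> real) \<Rightarrow> bool" where
  "multiwell_potential W \<longleftrightarrow>
     (\<exists>\<alpha>. 0 < \<alpha> \<and> \<alpha> < 1 \<and> Ck_holder 3 \<alpha> W) \<and>
     (\<forall>v. W (v + 1) = W v) \<and>
     (\<forall>v\<in>\<int>. W v = 0) \<and>
     (\<forall>v. v \<notin> \<int> \<longrightarrow> W v > 0) \<and>
     (deriv ^^ 2) W 0 > 0"

text \<open>Principal value at the singularity \<open>y = 0\<close>.\<close>

definition PV_integral :: "(real \<Rightarrow> real) \<Rightarrow> real" where
  "PV_integral g = Lim (at_right 0) (\<lambda>\<epsilon>. LINT y:{y. \<epsilon> < \<bar>y\<bar>}|lborel. g y)"

text \<open>For \<open>\<phi>\<close> bounded and of class \<open>C\<^sup>2\<close> and \<open>s \<in> (0,1)\<close> the truncated integrals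
  are absolutely convergent and the limit defining the principal value exists.\<close>

definition frac_op :: "real \<Rightarrow> (real \<Rightarrow> real) \<Rightarrow> real \<Rightarrow> real" where
  "frac_op s \<phi> x = PV_integral (\<lambda>y. (\<phi> (x + y) - \<phi> x) / \<bar>y\<bar> powr (1 + 2 * s))"

definition layer_solution :: "real \<Rightarrow> (real \<Rightarrow> real) \<Rightarrow> (real \<Rightarrow> real) \<Rightarrow> bool" where
  "layer_solution s W u \<longleftrightarrow>
     Ck 2 u \<and> bounded (range u) \<and>
     (\<forall>x. frac_op s u x = deriv W (u x)) \<and>
     (\<forall>x. deriv u x > 0) \<and>
     (u \<longlongrightarrow> 0) at_bot \<and> (u \<longlongrightarrow> 1) at_top \<and> u 0 = 1/2"

text \<open>Meaningful only if \<open>u'\<close> is square integrable: otherwise the integral below is 0 by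
  convention.\<close>

definition layer_gamma :: "(real \<Rightarrow> real) \<Rightarrow> real" where
  "layer_gamma u = inverse (LINT x|lborel. (deriv u x)\<^sup>2)"

text \<open>Particles are indexed by \<open>{1..N}\<close>; \<open>x i t\<close> is the position of particle \<open>i\<close> at time
  \<open>t\<close>. Values at other indices, and at times outside \<open>[0,T)\<close>, are irrelevant.\<close>

definition particle_velocity ::
    "real \<Rightarrow> real \<Rightarrow> nat \<Rightarrow> (nat \<Rightarrow> real) \<Rightarrow> (nat \<Rightarrow> real) \<Rightarrow> nat \<Rightarrow> real" where
  "particle_velocity \<gamma> s N \<zeta> X i =
     \<gamma> * (\<Sum>j\<in>{1..N} - {i}. \<zeta> i * \<zeta> j * ((X i - X j) / (2 * s * \<bar>X i - X j\<bar> powr (1 + 2 * s))))"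

definition particle_solution ::
    "real \<Rightarrow> real \<Rightarrow> nat \<Rightarrow> (nat \<Rightarrow> real) \<Rightarrow> (nat \<Rightarrow> real) \<Rightarrow> ereal \<Rightarrow> (nat \<Rightarrow> real \<Rightarrow> real) \<Rightarrow> bool" where
  "particle_solution \<gamma> s N \<zeta> x0 T x \<longleftrightarrow>
     (\<forall>i\<in>{1..N}. x i 0 = x0 i) \<and>
     (\<forall>i\<in>{1..N}. continuous_on {t. 0 \<le> t \<and> ereal t < T} (x i)) \<and>
     (\<forall>t. 0 \<le> t \<and> ereal t < T \<longrightarrow> (\<forall>i\<in>{1..N}. \<forall>j\<in>{1..N}. i \<noteq> j \<longrightarrow> x i t \<noteq> x j t)) \<and>
     (\<forall>t. 0 < t \<and> ereal t < T \<longrightarrow> (\<forall>i\<in>{1..N}.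
        (x i has_real_derivative particle_velocity \<gamma> s N \<zeta> (\<lambda>j. x j t) i) (at t)))"

text \<open>\<open>(0,T)\<close> is the maximal interval of existence of a collision-free solution, that is,
  \<open>x\<close> has no proper extension; \<open>T = \<infinity>\<close> is allowed.\<close>

definition maximal_particle_solution ::
    "real \<Rightarrow> real \<Rightarrow> nat \<Rightarrow> (nat \<Rightarrow> real) \<Rightarrow> (nat \<Rightarrow> real) \<Rightarrow> ereal \<Rightarrow> (nat \<Rightarrow> real \<Rightarrow> real) \<Rightarrow> bool" where
  "maximal_particle_solution \<gamma> s N \<zeta> x0 T x \<longleftrightarrow>
     0 < T \<and> particle_solution \<gamma> s N \<zeta> x0 T x \<and>
     \<not> (\<exists>T' y. T < T' \<and> particle_solution \<gamma> s N \<zeta> x0 T' y \<and>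
          (\<forall>i\<in>{1..N}. \<forall>t. 0 \<le> t \<and> ereal t < T \<longrightarrow> y i t = x i t))"

definition gap :: "(nat \<Rightarrow> real) \<Rightarrow> nat \<Rightarrow> real" where
  "gap X j = X (Suc j) - X j"

text \<open>Minimum of the gaps with index in \<open>{1..N-1} - {i}\<close>; for \<open>N = 2\<close> it is \<open>\<infinity>\<close>, whence the
  extended reals.\<close>

definition min_other_gap :: "nat \<Rightarrow> (nat \<Rightarrow> real) \<Rightarrow> nat \<Rightarrow> ereal" where
  "min_other_gap N X i = (INF j\<in>{1..N-1} - {i}. ereal (gap X j))"

end

theory Submission
  imports Defs
begin

text \<open>Write \<open>\<theta> j\<close> for the gaps. Two neighbours of opposite orientation attract each other at rate
  \<open>\<gamma>/s * \<theta> i powr (-2s)\<close>, while every other distance is at least \<open>\<theta> i / a\<close>, so that all other forces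
  carry a factor \<open>a powr (2s)\<close>. The attraction also pulls the neighbouring gaps open. Hence
  \<open>\<theta> i - a * \<theta> j\<close> is nonincreasing as long as it is nonpositive, and
  \<open>(\<theta> i powr (2s+1))' \<le> - (2s+1) * \<gamma>/s * (1 - (N-2) * a powr (2s))\<close>, which bounds the lifetime.
  If \<open>\<theta> i\<close> stayed away from zero, so would all distances, and by Picard--Lindeloef the solution could be
  continued, against maximality.\<close>

subsection \<open>The Picard--Lindeloef theorem\<close>

text \<open>The sign of the derivative of \<open>\<theta> i - a * \<theta> j\<close> is known only
  while the pair is close, the very property to be proved, and closeness with factor
  \<open>a\<close> may hold with equality, so continuity alone does not preserve it. Closeness with
  a larger factor \<open>b\<close> does persist briefly. Velocities are therefore estimated with
  \<open>b\<close> and the conclusion is drawn with \<open>a\<close>. In units of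
  \<open>\<gamma>/s * \<theta> i powr (-2s)\<close>, the N - 2 outside particles weaken the
  attraction by at most \<open>(N - 2) * b powr (2s)\<close>, and the N - 1 forces on each end of
  gap \<open>j\<close> shrink it at a rate of at most \<open>(N - 1) * b powr (2s)\<close>, which
  enters with weight \<open>a\<close>. Hence the requirement
  \<open>(N - 2 + a * (N - 1)) * b powr (2s) < 1\<close>. Maximality only forbids extensions, so a
  contradiction needs a complete extended solution, including its derivative at the joint, where the
  local solution provides only a one-sided one. There the derivative is recovered from continuity of
  the velocity.\<close>

theorem picard_banach:
  fixes f :: "'a::banach \<Rightarrow> 'a"
  assumes lip: "L-lipschitz_on (cball X r) f" and "r > 0"
  obtains \<delta> y where "\<delta> > 0" and "y 0 = X" and "\<And>t. t \<in> {0..\<delta>} \<Longrightarrow> y t \<in> cball X r"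
    and "\<And>t. t \<in> {0..\<delta>} \<Longrightarrow> (y has_vector_derivative f (y t)) (at t within {0..\<delta>})"
proof -
  \<comment> \<open>\<open>M\<close> bounds \<open>norm (f v)\<close> on the ball; the summand 1
    makes \<open>r / M\<close> meaningful even if \<open>f\<close> vanishes there.\<close>
  define M where "M = norm (f X) + L * r + 1"
  have L: "L \<ge> 0" using lip by (rule lipschitz_on_nonneg)
  have M: "M > 0" using L \<open>r > 0\<close> by (auto simp: M_def intro!: add_nonneg_pos)
  \<comment> \<open>The first bound gives the contraction factor 1/2, with \<open>L + 1\<close> in
    place of a possibly zero \<open>L\<close>; the second keeps curves of speed at most
    \<open>M\<close> inside the ball.\<close>
  define \<delta> where "\<delta> = min (1 / (2 * (L + 1))) (r / M)"
  have \<delta>: "\<delta> > 0" using L M \<open>r > 0\<close> by (auto simp: \<delta>_def)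
  have \<delta>M: "M * \<delta> \<le> r"
    using M by (auto simp: \<delta>_def min_def field_simps)
  have "L * \<delta> \<le> L * (1 / (2 * (L + 1)))"
    using L by (intro mult_left_mono) (auto simp: \<delta>_def)
  also have "\<dots> \<le> 1/2" using L by (simp add: field_simps)
  finally have \<delta>L: "L * \<delta> \<le> 1/2" .
  have fbound: "norm (f v) \<le> M" if "v \<in> cball X r" for v
  proof -
    have "dist (f v) (f X) \<le> L * dist v X"
      using that \<open>r > 0\<close> by (intro lipschitz_onD[OF lip]) auto
    also have "\<dots> \<le> L * r"
      using that L by (intro mult_left_mono) (auto simp: dist_commute)
    finally show ?thesis
      using norm_triangle_ineq2[of "f v" "f X"] by (auto simp: M_def dist_norm)
  qed
  \<comment> \<open>Clamping time to \<open>{0..\<delta>}\<close> turns the integral operator into a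
    map on bounded continuous functions of the whole line, the complete space at hand.\<close>
  define cl where "cl = (\<lambda>t. max 0 (min \<delta> t))"
  have cl: "cl t \<in> {0..\<delta>}" for t using \<delta> by (auto simp: cl_def)
  have cl_id: "cl t = t" if "t \<in> {0..\<delta>}" for t using that by (auto simp: cl_def)
  have cl_cont: "continuous_on A cl" for A
    unfolding cl_def by (intro continuous_intros)
  \<comment> \<open>A ball around the constant curve in the sup norm: its members take values in
    \<open>cball X r\<close> at every time, where \<open>f\<close> is Lipschitz.\<close>
  define D :: "(real \<Rightarrow>\<^sub>C 'a) set" where "D = cball (const_bcontfun X) r"
  have D_in: "\<phi> t \<in> cball X r" if "\<phi> \<in> D" for \<phi> t
    using that dist_bounded[of "const_bcontfun X" t \<phi>]
    by (auto simp: D_def const_bcontfun.rep_eq)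
  have fcont: "continuous_on A (\<lambda>t. f (\<phi> t))" if "\<phi> \<in> D" for \<phi> A
    by (rule continuous_on_compose2[OF lipschitz_on_continuous_on[OF lip]])
       (use D_in that in auto)
  define I where "I = (\<lambda>\<phi>::real \<Rightarrow>\<^sub>C 'a. \<lambda>t. X + integral {0..cl t} (\<lambda>\<tau>. f (\<phi> \<tau>)))"
  define \<Phi> where "\<Phi> = (\<lambda>\<phi>. Bcontfun (I \<phi>))"
  have I_dist: "norm (I \<phi> t - X) \<le> r" if "\<phi> \<in> D" for \<phi> t
  proof -
    have "norm (integral {0..cl t} (\<lambda>\<tau>. f (\<phi> \<tau>))) \<le> M * (cl t - 0)"
      by (rule integral_bound) (use cl[of t] fcont that fbound D_in in auto)
    also have "\<dots> \<le> M * \<delta>" using M cl[of t] by (intro mult_left_mono) auto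
    finally show ?thesis using \<delta>M by (simp add: I_def)
  qed
  have I_in: "I \<phi> \<in> bcontfun" if "\<phi> \<in> D" for \<phi>
  proof (rule bcontfun_normI)
    have "continuous_on {0..\<delta>} (\<lambda>x. integral {0..x} (\<lambda>\<tau>. f (\<phi> \<tau>)))"
      by (intro indefinite_integral_continuous_1 integrable_continuous_real fcont that)
    then show "continuous_on UNIV (I \<phi>)"
      unfolding I_def
      by (intro continuous_intros continuous_on_compose2[OF _ cl_cont]) (use cl in auto)
    show "norm (I \<phi> t) \<le> norm X + r" for t
      using I_dist[OF that, of t] norm_triangle_ineq2[of "I \<phi> t" X] by simp
  qed
  have \<Phi>: "apply_bcontfun (\<Phi> \<phi>) = I \<phi>" if "\<phi> \<in> D" for \<phi>
    using I_in[OF that] by (simp add: \<Phi>_def Bcontfun_inverse)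
  have "\<exists>!\<phi>\<in>D. \<Phi> \<phi> = \<phi>"
  proof (rule Banach_fix[where c = "1/2"])
    show "complete D" by (simp add: D_def complete_eq_closed)
    have "const_bcontfun X \<in> D" using \<open>r > 0\<close> by (simp add: D_def)
    then show "D \<noteq> {}" by blast
    show "\<Phi> ` D \<subseteq> D"
    proof safe
      fix \<phi> assume "\<phi> \<in> D"
      then show "\<Phi> \<phi> \<in> D"
        using I_dist \<Phi>
        unfolding D_def mem_cball
        by (intro dist_bound) (auto simp: const_bcontfun.rep_eq dist_norm norm_minus_commute D_def)
    qed
    show "dist (\<Phi> \<phi>) (\<Phi> \<psi>) \<le> 1/2 * dist \<phi> \<psi>" if "\<phi> \<in> D" "\<psi> \<in> D" for \<phi> \<psi>
    proof (rule dist_bound)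
      fix t
      have "norm (f (\<phi> \<tau>) - f (\<psi> \<tau>)) \<le> L * dist \<phi> \<psi>" for \<tau>
      proof -
        have "norm (f (\<phi> \<tau>) - f (\<psi> \<tau>)) \<le> L * dist (\<phi> \<tau>) (\<psi> \<tau>)"
          unfolding dist_norm[symmetric, of "f _"]
          by (intro lipschitz_onD[OF lip] D_in that)
        also have "\<dots> \<le> L * dist \<phi> \<psi>" by (intro mult_left_mono dist_bounded L)
        finally show ?thesis .
      qed
      then have "norm (integral {0..cl t} (\<lambda>\<tau>. f (\<phi> \<tau>) - f (\<psi> \<tau>))) \<le> L * dist \<phi> \<psi> * (cl t - 0)"
        by (intro integral_bound continuous_intros fcont that) (use cl[of t] in auto)
      also have "\<dots> \<le> L * dist \<phi> \<psi> * \<delta>"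
        using cl[of t] L by (intro mult_left_mono) auto
      also have "\<dots> = (L * \<delta>) * dist \<phi> \<psi>" by simp
      also have "\<dots> \<le> 1/2 * dist \<phi> \<psi>" by (intro mult_right_mono \<delta>L) simp
      finally show "dist (\<Phi> \<phi> t) (\<Phi> \<psi> t) \<le> 1/2 * dist \<phi> \<psi>"
        using that by (simp add: \<Phi> I_def dist_norm integral_diff integrable_continuous_real fcont)
    qed
  qed auto
  then obtain \<phi> where \<phi>: "\<phi> \<in> D" "\<Phi> \<phi> = \<phi>" by auto
  have \<phi>_eq: "\<phi> t = X + integral {0..t} (\<lambda>\<tau>. f (\<phi> \<tau>))" if "t \<in> {0..\<delta>}" for t
    using fun_cong[OF \<Phi>[OF \<phi>(1)], of t] \<phi>(2) cl_id[OF that] by (simp add: I_def)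
  show thesis
  proof (rule that[of \<delta> \<phi>])
    show "\<phi> 0 = X" using \<phi>_eq[of 0] \<delta> by simp
    show "(apply_bcontfun \<phi> has_vector_derivative f (\<phi> t)) (at t within {0..\<delta>})"
      if t: "t \<in> {0..\<delta>}" for t
    proof (rule has_vector_derivative_transform[OF t])
      show "((\<lambda>u. X + integral {0..u} (\<lambda>\<tau>. f (\<phi> \<tau>))) has_vector_derivative f (\<phi> t))
          (at t within {0..\<delta>})"
        using has_vector_derivative_add[OF has_vector_derivative_const
            integral_has_vector_derivative[OF fcont[OF \<phi>(1)] t]]
        by simp
    qed (use \<phi>_eq in auto)
  qed (use \<delta> D_in[OF \<phi>(1)] in auto)
qed

instance bcontfun :: (metric_space, banach) banach ..

text \<open>The library proves completeness of the bounded continuous functions only over a metric domain;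
  with this metric on \<open>nat\<close>, the bounded sequences become a Banach space that contains the
  configurations of any number of particles.\<close>

instantiation nat :: metric_space
begin

definition dist_nat :: "nat \<Rightarrow> nat \<Rightarrow> real" where
  "dist_nat m n = \<bar>real m - real n\<bar>"

definition uniformity_nat :: "(nat \<times> nat) filter" where
  "uniformity_nat = (INF e\<in>{0 <..}. principal {(m, n). dist m n < e})"

instance
proof
  fix U :: "nat set"
  have "\<forall>\<^sub>F (m :: nat, n) in uniformity. m = n"
    unfolding uniformity_nat_def
    by (rule eventually_INF1[of 1]) (auto simp: eventually_principal dist_nat_def)
  then have "\<forall>\<^sub>F (m', n) in uniformity. m' = m \<longrightarrow> n \<in> U" if "m \<in> U" for m
    by (rule eventually_mono) (use that in auto)
  then show "open U = (\<forall>m\<in>U. \<forall>\<^sub>F (m', n) in uniformity. m' = m \<longrightarrow> n \<in> U)"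
    by (auto intro: open_discrete)
qed (auto simp: uniformity_nat_def dist_nat_def)

end

text \<open>Coordinates outside \<open>I\<close> are set to zero, so that a configuration becomes a
  bounded sequence and the sup norm measures only \<open>I\<close>. With \<open>D = 0\<close>, the
  hypothesis \<open>lip\<close> also says that \<open>F Y i\<close> depends only on the coordinates
  in \<open>I\<close> as long as \<open>Y\<close> stays in the box.\<close>

lemma picard_finite_index:
  fixes F :: "(nat \<Rightarrow> real) \<Rightarrow> nat \<Rightarrow> real" and X :: "nat \<Rightarrow> real"
  assumes "finite I" "r > 0" "L \<ge> 0"
    and lip: "\<And>Y Z D i. \<lbrakk>i \<in> I; \<And>j. j \<in> I \<Longrightarrow> \<bar>Y j - X j\<bar> \<le> r; \<And>j. j \<in> I \<Longrightarrow> \<bar>Z j - X j\<bar> \<le> r;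
        \<And>j. j \<in> I \<Longrightarrow> \<bar>Y j - Z j\<bar> \<le> D\<rbrakk> \<Longrightarrow> \<bar>F Y i - F Z i\<bar> \<le> L * D"
  obtains \<delta> y where "\<delta> > 0" and "\<And>i. i \<in> I \<Longrightarrow> y i 0 = X i"
    and "\<And>i t. \<lbrakk>i \<in> I; t \<in> {0..\<delta>}\<rbrakk> \<Longrightarrow> \<bar>y i t - X i\<bar> \<le> r"
    and "\<And>i t. \<lbrakk>i \<in> I; t \<in> {0..\<delta>}\<rbrakk> \<Longrightarrow>
          (y i has_real_derivative F (\<lambda>j. y j t) i) (at t within {0..\<delta>})"
proof -
  define emb :: "(nat \<Rightarrow> real) \<Rightarrow> nat \<Rightarrow>\<^sub>C real"
    where "emb = (\<lambda>v. Bcontfun (\<lambda>i. if i \<in> I then v i else 0))"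
  have emb: "apply_bcontfun (emb v) = (\<lambda>i. if i \<in> I then v i else 0)" for v
  proof -
    have "range (\<lambda>i. if i \<in> I then v i else 0) \<subseteq> insert 0 (v ` I)" by auto
    then have "bounded (range (\<lambda>i. if i \<in> I then v i else 0))"
      using \<open>finite I\<close> by (meson bounded_subset finite_imageI finite_imp_bounded finite_insert)
    then show ?thesis
      unfolding emb_def by (intro Bcontfun_inverse) (simp add: bcontfun_def)
  qed
  define f :: "(nat \<Rightarrow>\<^sub>C real) \<Rightarrow> nat \<Rightarrow>\<^sub>C real"
    where "f = (\<lambda>Y. emb (F (apply_bcontfun Y)))"
  have box: "\<bar>Y j - X j\<bar> \<le> r" if "Y \<in> cball (emb X) r" "j \<in> I" for Y j
    using that dist_bounded[of "emb X" j Y] by (simp add: emb dist_real_def)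
  have "L-lipschitz_on (cball (emb X) r) f"
  proof (rule lipschitz_onI)
    fix Y Z assume YZ: "Y \<in> cball (emb X) r" "Z \<in> cball (emb X) r"
    show "dist (f Y) (f Z) \<le> L * dist Y Z"
    proof (rule dist_bound)
      fix i
      show "dist (f Y i) (f Z i) \<le> L * dist Y Z"
      proof (cases "i \<in> I")
        case True
        have "\<bar>F Y i - F Z i\<bar> \<le> L * dist Y Z"
          by (intro lip True box YZ) (use dist_bounded in \<open>auto simp: dist_real_def[symmetric]\<close>)
        with True show ?thesis by (simp add: f_def emb dist_real_def)
      qed (use \<open>L \<ge> 0\<close> in \<open>simp add: f_def emb\<close>)
    qed
  qed fact
  from picard_banach[OF this \<open>r > 0\<close>] obtain \<delta> y where y: "\<delta> > 0" "y 0 = emb X"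
    "\<And>t. t \<in> {0..\<delta>} \<Longrightarrow> y t \<in> cball (emb X) r"
    "\<And>t. t \<in> {0..\<delta>} \<Longrightarrow> (y has_vector_derivative f (y t)) (at t within {0..\<delta>})"
    by blast
  show thesis
  proof (rule that[of \<delta> "\<lambda>i t. y t i"])
    show "\<delta> > 0" by fact
    show "y 0 i = X i" if "i \<in> I" for i using that y(2) by (simp add: emb)
    show "\<bar>y t i - X i\<bar> \<le> r" if "i \<in> I" "t \<in> {0..\<delta>}" for i t using that box y(3) by blast
    show "((\<lambda>t. y t i) has_real_derivative F (\<lambda>j. y t j) i) (at t within {0..\<delta>})"
      if "i \<in> I" "t \<in> {0..\<delta>}" for i t
    proof -
      \<comment> \<open>Evaluation at a coordinate is continuous and linear, so the derivative in
        the sequence space passes to each particle.\<close>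
      have "bounded_linear (\<lambda>g :: nat \<Rightarrow>\<^sub>C real. g i)"
        by (rule bounded_linear_intro[where K = 1]) (use norm_bounded[of _ i] in \<open>auto simp flip: real_norm_def\<close>)
      from bounded_linear.has_vector_derivative[OF this y(4)[OF that(2)]]
      show ?thesis using that
        by (simp add: has_real_derivative_iff_has_vector_derivative f_def emb)
    qed
  qed
qed

section \<open>Calculus for joining and estimating trajectories\<close>

lemma has_real_derivative_at_exceptional_point:
  fixes f f' :: "real \<Rightarrow> real"
  assumes "a < c" "c < b" and cont: "continuous_on {a..b} f" "continuous_on {a..b} f'"
    and deriv: "\<And>t. \<lbrakk>a < t; t < b; t \<noteq> c\<rbrakk> \<Longrightarrow> (f has_real_derivative f' t) (at t)"
  shows "(f has_real_derivative f' c) (at c)"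
proof -
  have f_eq: "f t = f a + integral {a..t} f'" if "t \<in> {a..b}" for t
  proof -
    \<comment> \<open>The fundamental theorem tolerates the exceptional point \<open>c\<close>; thus
      \<open>f\<close> is an integral of \<open>f'\<close>, which is differentiable at
      \<open>c\<close> because \<open>f'\<close> is continuous there.\<close>
    have "(f' has_integral (f t - f a)) {a..t}"
      by (rule fundamental_theorem_of_calculus_interior_strong[of "{c}"])
         (use that deriv in \<open>auto simp: has_real_derivative_iff_has_vector_derivative
             intro: continuous_on_subset[OF cont(1)]\<close>)
    then show ?thesis by (simp add: integral_unique)
  qed
  have "((\<lambda>t. f a + integral {a..t} f') has_real_derivative 0 + f' c) (at c within {a..b})"
    using assms by (intro DERIV_add DERIV_const integral_has_real_derivative) auto
  then have "(f has_real_derivative f' c) (at c within {a..b})"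
    unfolding has_real_derivative_iff_has_vector_derivative
    using has_vector_derivative_transform[of c "{a..b}" f, OF _ f_eq] assms by simp
  moreover have "at c within {a..b} = at c" by (rule at_within_Icc_at) fact+
  ultimately show ?thesis by simp
qed

lemma abs_increment_le:
  fixes f f' :: "real \<Rightarrow> real"
  assumes "a \<le> b" and cont: "continuous_on {a..b} f"
    and deriv: "\<And>t. \<lbrakk>a < t; t < b\<rbrakk> \<Longrightarrow> (f has_real_derivative f' t) (at t)"
    and bound: "\<And>t. \<lbrakk>a < t; t < b\<rbrakk> \<Longrightarrow> \<bar>f' t\<bar> \<le> B"
  shows "\<bar>f b - f a\<bar> \<le> B * (b - a)"
proof (cases "a = b")
  case False
  then have "a < b" using assms by simp
  from MVT[OF this cont] deriv obtain l z where z: "a < z" "z < b" "DERIV f z :> l"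
    "f b - f a = (b - a) * l" by (metis real_differentiable_def)
  then have "l = f' z" using deriv DERIV_unique by blast
  with z bound[of z] \<open>a < b\<close> show ?thesis by (simp add: abs_mult mult.commute)
qed simp

subsection \<open>Velocities\<close>

text \<open>The interaction kernel without orientations and the factor
  \<open>\<gamma> / (2 * s)\<close>: an odd function, equal to \<open>d powr (- 2 * s)\<close> for
  positive \<open>d\<close> and to 0 at \<open>d = 0\<close> by the convention on division.\<close>

definition pair_force :: "real \<Rightarrow> real \<Rightarrow> real" where
  "pair_force s d = d / \<bar>d\<bar> powr (1 + 2 * s)"

lemma particle_velocity_pair_force:
  "particle_velocity \<gamma> s N \<zeta> X i =
     \<gamma> / (2 * s) * (\<Sum>j\<in>{1..N} - {i}. \<zeta> i * \<zeta> j * pair_force s (X i - X j))"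
  unfolding particle_velocity_def pair_force_def sum_distrib_left
  by (intro sum.cong) (auto simp: field_simps)

lemma pair_force_minus: "pair_force s (- d) = - pair_force s d"
  by (simp add: pair_force_def)

lemma pair_force_pos:
  assumes "d > 0" shows "pair_force s d = d powr (- 2 * s)"
proof -
  have "d powr (- 2 * s) = d powr (1 - (1 + 2 * s))" by simp
  also have "\<dots> = d powr 1 / d powr (1 + 2 * s)" by (rule powr_diff)
  finally show ?thesis using assms by (simp add: pair_force_def)
qed

lemma abs_pair_force:
  assumes "d \<noteq> 0" shows "\<bar>pair_force s d\<bar> = \<bar>d\<bar> powr (- 2 * s)"
proof -
  have "\<bar>pair_force s d\<bar> = \<bar>pair_force s \<bar>d\<bar>\<bar>" by (simp add: abs_if pair_force_minus)
  with assms show ?thesis by (simp add: pair_force_pos)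
qed

lemma abs_pair_force_le:
  assumes "s > 0" "m > 0" "m \<le> \<bar>d\<bar>" shows "\<bar>pair_force s d\<bar> \<le> m powr (- 2 * s)"
  using assms by (subst abs_pair_force) (auto intro: powr_mono2')

text \<open>On distances of at least \<open>m\<close> the slope of the power is steepest at
  \<open>m\<close>.\<close>

lemma pair_force_lipschitz_pos:
  assumes "s > 0" "m > 0" "m \<le> a" "m \<le> b"
  shows "\<bar>pair_force s a - pair_force s b\<bar> \<le> 2 * s * m powr (- 2 * s - 1) * \<bar>a - b\<bar>"
proof -
  have *: "\<bar>b powr (- 2 * s) - a powr (- 2 * s)\<bar> \<le> 2 * s * m powr (- 2 * s - 1) * (b - a)"
    if "m \<le> a" "a \<le> b" for a b
  proof (rule abs_increment_le[OF \<open>a \<le> b\<close>])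
    show "continuous_on {a..b} (\<lambda>d. d powr (- 2 * s))"
      using that \<open>m > 0\<close> by (intro continuous_intros) auto
    fix t assume t: "a < t" "t < b"
    show "((\<lambda>d. d powr (- 2 * s)) has_real_derivative (- 2 * s) * t powr (- 2 * s - 1)) (at t)"
      using that t \<open>m > 0\<close> by (auto intro!: derivative_eq_intros)
    have "t powr (- 2 * s - 1) \<le> m powr (- 2 * s - 1)"
      using that t assms by (intro powr_mono2') auto
    then show "\<bar>(- 2 * s) * t powr (- 2 * s - 1)\<bar> \<le> 2 * s * m powr (- 2 * s - 1)"
      using \<open>s > 0\<close> by (simp add: abs_mult)
  qed
  show ?thesis
    using *[of a b] *[of b a] assms by (cases "a \<le> b") (auto simp: pair_force_pos)
qed

text \<open>The condition \<open>0 \<le> a * b\<close> keeps both arguments on the same side of the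
  singularity, across which the force changes sign; oddness reduces the negative side to the
  positive one.\<close>

lemma pair_force_lipschitz:
  assumes "s > 0" "m > 0" "m \<le> \<bar>a\<bar>" "m \<le> \<bar>b\<bar>" "0 \<le> a * b"
  shows "\<bar>pair_force s a - pair_force s b\<bar> \<le> 2 * s * m powr (- 2 * s - 1) * \<bar>a - b\<bar>"
proof (cases "a > 0")
  case True
  with assms have "b \<ge> m" by (auto simp: abs_if zero_le_mult_iff split: if_splits)
  with True assms show ?thesis by (intro pair_force_lipschitz_pos) auto
next
  case False
  with assms have "- b \<ge> m" "- a \<ge> m" by (auto simp: abs_if zero_le_mult_iff split: if_splits)
  then show ?thesis
    using pair_force_lipschitz_pos[OF assms(1,2), of "- a" "- b"]
    by (simp add: pair_force_minus abs_minus_commute)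
qed

lemma abs_particle_velocity_le:
  assumes "s > 0" "m > 0" and \<zeta>: "\<And>j. j \<in> {1..N} \<Longrightarrow> \<zeta> j \<in> {-1, 1}" and i: "i \<in> {1..N}"
    and sep: "\<And>j. \<lbrakk>j \<in> {1..N}; j \<noteq> i\<rbrakk> \<Longrightarrow> m \<le> \<bar>X i - X j\<bar>"
  shows "\<bar>particle_velocity \<gamma> s N \<zeta> X i\<bar> \<le> \<bar>\<gamma>\<bar> / (2 * s) * (N * m powr (- 2 * s))"
proof -
  have "\<bar>\<Sum>j\<in>{1..N} - {i}. \<zeta> i * \<zeta> j * pair_force s (X i - X j)\<bar>
      \<le> (\<Sum>j\<in>{1..N} - {i}. m powr (- 2 * s))"
  proof (rule order.trans[OF sum_abs], rule sum_mono)
    fix j assume j: "j \<in> {1..N} - {i}"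
    have "\<bar>\<zeta> i * \<zeta> j\<bar> = 1" using \<zeta>[of i] \<zeta>[of j] i j by (auto simp: abs_mult)
    then show "\<bar>\<zeta> i * \<zeta> j * pair_force s (X i - X j)\<bar> \<le> m powr (- 2 * s)"
      using abs_pair_force_le[OF assms(1,2) sep, of j] j by (simp add: abs_mult)
  qed
  also have "\<dots> \<le> N * m powr (- 2 * s)"
    using i by (simp add: mult_right_mono)
  finally show ?thesis
    unfolding particle_velocity_pair_force abs_mult using \<open>s > 0\<close>
    by (intro mult_mono) auto
qed

text \<open>If every particle moves by at most \<open>m / 4\<close>, a difference of two positions
  changes by at most \<open>m / 2\<close>: it keeps its sign and stays at least \<open>m / 2\<close>
  away from zero. Such a difference varies by at most \<open>2 * D\<close>, whence
  \<open>4 * s\<close> instead of \<open>2 * s\<close>.\<close>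

lemma particle_velocity_lipschitz:
  assumes "s > 0" "m > 0" and \<zeta>: "\<And>j. j \<in> {1..N} \<Longrightarrow> \<zeta> j \<in> {-1, 1}"
    and sep: "\<And>i j. \<lbrakk>i \<in> {1..N}; j \<in> {1..N}; i \<noteq> j\<rbrakk> \<Longrightarrow> m \<le> \<bar>X i - X j\<bar>"
    and Y: "\<And>j. j \<in> {1..N} \<Longrightarrow> \<bar>Y j - X j\<bar> \<le> m / 4"
    and Z: "\<And>j. j \<in> {1..N} \<Longrightarrow> \<bar>Z j - X j\<bar> \<le> m / 4"
    and D: "\<And>j. j \<in> {1..N} \<Longrightarrow> \<bar>Y j - Z j\<bar> \<le> D"
    and i: "i \<in> {1..N}"
  shows "\<bar>particle_velocity \<gamma> s N \<zeta> Y i - particle_velocity \<gamma> s N \<zeta> Z i\<bar>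
    \<le> \<bar>\<gamma>\<bar> / (2 * s) * (N * (4 * s * (m / 2) powr (- 2 * s - 1))) * D"
proof -
  let ?l = "2 * s * (m / 2) powr (- 2 * s - 1)"
  have "D \<ge> 0" using D[OF i] by linarith
  have "\<bar>\<Sum>j\<in>{1..N} - {i}. \<zeta> i * \<zeta> j * (pair_force s (Y i - Y j) - pair_force s (Z i - Z j))\<bar>
      \<le> (\<Sum>j\<in>{1..N} - {i}. ?l * (2 * D))"
  proof (rule order.trans[OF sum_abs], rule sum_mono)
    fix j assume j: "j \<in> {1..N} - {i}"
    from j have jN: "j \<in> {1..N}" by simp
    have near: "\<bar>(Y i - Y j) - (X i - X j)\<bar> \<le> m / 2" "\<bar>(Z i - Z j) - (X i - X j)\<bar> \<le> m / 2"
      using Y[OF i] Y[OF jN] Z[OF i] Z[OF jN] by linarith+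
    have far: "m \<le> \<bar>X i - X j\<bar>" using sep i j by auto
    have "0 \<le> (Y i - Y j) * (Z i - Z j)"
      unfolding zero_le_mult_iff using near far \<open>m > 0\<close> by linarith
    moreover have "m / 2 \<le> \<bar>Y i - Y j\<bar>" "m / 2 \<le> \<bar>Z i - Z j\<bar>"
      using near far by linarith+
    ultimately have "\<bar>pair_force s (Y i - Y j) - pair_force s (Z i - Z j)\<bar>
        \<le> ?l * \<bar>(Y i - Y j) - (Z i - Z j)\<bar>"
      using assms(1,2) by (intro pair_force_lipschitz) auto
    also have "\<dots> \<le> ?l * (2 * D)"
      using D[of i] D[of j] i j \<open>s > 0\<close> by (intro mult_left_mono) auto
    finally have "\<bar>pair_force s (Y i - Y j) - pair_force s (Z i - Z j)\<bar> \<le> ?l * (2 * D)" .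
    moreover have "\<bar>\<zeta> i * \<zeta> j\<bar> = 1" using \<zeta>[of i] \<zeta>[of j] i j by (auto simp: abs_mult)
    ultimately show "\<bar>\<zeta> i * \<zeta> j * (pair_force s (Y i - Y j) - pair_force s (Z i - Z j))\<bar>
        \<le> ?l * (2 * D)" by (simp add: abs_mult)
  qed
  also have "\<dots> \<le> N * (?l * (2 * D))"
    using i \<open>s > 0\<close> \<open>D \<ge> 0\<close>
    by (simp only: sum_constant) (intro mult_right_mono, auto)
  finally have sum: "\<bar>\<Sum>j\<in>{1..N} - {i}. \<zeta> i * \<zeta> j * (pair_force s (Y i - Y j) - pair_force s (Z i - Z j))\<bar>
      \<le> N * (?l * (2 * D))" .
  have "particle_velocity \<gamma> s N \<zeta> Y i - particle_velocity \<gamma> s N \<zeta> Z i = \<gamma> / (2 * s) *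
      (\<Sum>j\<in>{1..N} - {i}. \<zeta> i * \<zeta> j * (pair_force s (Y i - Y j) - pair_force s (Z i - Z j)))"
    unfolding particle_velocity_pair_force by (simp add: right_diff_distrib sum_subtractf)
  also have "\<bar>\<dots>\<bar> \<le> \<bar>\<gamma>\<bar> / (2 * s) * (N * (?l * (2 * D)))"
    unfolding abs_mult using \<open>s > 0\<close> by (intro mult_mono sum) auto
  finally show ?thesis by (simp add: algebra_simps)
qed

lemma continuous_on_particle_velocity:
  assumes "\<And>j. j \<in> {1..N} \<Longrightarrow> continuous_on A (x j)" and "i \<in> {1..N}" "s > 0"
    and "\<And>j t. \<lbrakk>j \<in> {1..N}; j \<noteq> i; t \<in> A\<rbrakk> \<Longrightarrow> x i t \<noteq> x j t"
  shows "continuous_on A (\<lambda>t. particle_velocity \<gamma> s N \<zeta> (\<lambda>j. x j t) i)"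
  unfolding particle_velocity_def
  by (intro continuous_intros) (use assms in auto)

subsection \<open>Continuation of solutions\<close>

text \<open>Separation bounds the speeds, so positions are Lipschitz on \<open>{0..<T}\<close>,
  hence uniformly continuous, and extend continuously to \<open>T\<close>; the bound on distances
  passes to the limit.\<close>

lemma particle_solution_limits:
  assumes sol: "particle_solution \<gamma> s N \<zeta> x0 (ereal T) x" and "T > 0" "s > 0" "m > 0"
    and \<zeta>: "\<And>j. j \<in> {1..N} \<Longrightarrow> \<zeta> j \<in> {-1, 1}"
    and sep: "\<And>i j t. \<lbrakk>i \<in> {1..N}; j \<in> {1..N}; i \<noteq> j; 0 \<le> t; t < T\<rbrakk> \<Longrightarrow> m \<le> \<bar>x i t - x j t\<bar>"
  obtains g where "\<And>i. i \<in> {1..N} \<Longrightarrow> continuous_on {0..T} (g i)"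
    and "\<And>i t. \<lbrakk>i \<in> {1..N}; 0 \<le> t; t < T\<rbrakk> \<Longrightarrow> g i t = x i t"
    and "\<And>i j. \<lbrakk>i \<in> {1..N}; j \<in> {1..N}; i \<noteq> j\<rbrakk> \<Longrightarrow> m \<le> \<bar>g i T - g j T\<bar>"
proof -
  let ?B = "\<bar>\<gamma>\<bar> / (2 * s) * (N * m powr (- 2 * s))"
  have dom: "{t. 0 \<le> t \<and> ereal t < ereal T} = {0..<T}" by auto
  have "\<exists>g. continuous_on {0..T} g \<and> (\<forall>t\<in>{0..<T}. g t = x i t)" if i: "i \<in> {1..N}" for i
  proof -
    have "?B-lipschitz_on {0..<T} (x i)"
    proof (rule lipschitz_on_leI)
      fix a b assume ab: "a \<in> {0..<T}" "b \<in> {0..<T}" "a \<le> b"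
      have "\<bar>x i b - x i a\<bar> \<le> ?B * (b - a)"
      proof (rule abs_increment_le[OF \<open>a \<le> b\<close>])
        show "continuous_on {a..b} (x i)"
          by (rule continuous_on_subset[of "{0..<T}"])
             (use sol i ab in \<open>auto simp only: particle_solution_def dom atLeastAtMost_iff atLeastLessThan_iff\<close>)
        fix t assume t: "a < t" "t < b"
        show "(x i has_real_derivative particle_velocity \<gamma> s N \<zeta> (\<lambda>j. x j t) i) (at t)"
          using sol i ab t by (auto simp: particle_solution_def)
        show "\<bar>particle_velocity \<gamma> s N \<zeta> (\<lambda>j. x j t) i\<bar> \<le> ?B"
          using ab t by (intro abs_particle_velocity_le \<zeta> i sep assms) auto
      qed
      then show "dist (x i a) (x i b) \<le> ?B * dist a b"
        using ab by (simp add: dist_real_def abs_minus_commute)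
    qed (use \<open>s > 0\<close> in auto)
    from uniformly_continuous_on_extension_on_closure[OF lipschitz_on_uniformly_continuous[OF this]]
    show ?thesis using \<open>T > 0\<close>
      by (metis closure_atLeastLessThan uniformly_continuous_imp_continuous)
  qed
  then obtain g where g: "\<And>i. i \<in> {1..N} \<Longrightarrow> continuous_on {0..T} (g i)"
    "\<And>i t. \<lbrakk>i \<in> {1..N}; t \<in> {0..<T}\<rbrakk> \<Longrightarrow> g i t = x i t" by metis
  show thesis
  proof (rule that[of g])
    fix i j assume ij: "i \<in> {1..N}" "j \<in> {1..N}" "i \<noteq> j"
    have "continuous_on {0..T} (\<lambda>t. \<bar>g i t - g j t\<bar>)" by (intro continuous_intros g ij)
    then have "((\<lambda>t. \<bar>g i t - g j t\<bar>) \<longlongrightarrow> \<bar>g i T - g j T\<bar>) (at_left T)"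
      using \<open>T > 0\<close> by (simp add: continuous_on_def flip: at_within_Icc_at_left)
    moreover have "\<forall>\<^sub>F t in at_left T. m \<le> \<bar>g i t - g j t\<bar>"
      using eventually_at_left_real[OF \<open>T > 0\<close>] by eventually_elim (use g(2) sep ij in auto)
    ultimately show "m \<le> \<bar>g i T - g j T\<bar>"
      by (intro tendsto_lowerbound) auto
  qed (use g in auto)
qed

text \<open>A local solution started from the limit configuration is appended at time
  \<open>T\<close>. At the joint, the velocity along the glued trajectory is continuous, which makes
  \<open>has_real_derivative_at_exceptional_point\<close> applicable.\<close>

theorem particle_solution_extends:
  assumes sol: "particle_solution \<gamma> s N \<zeta> x0 (ereal T) x" and "T > 0" "s > 0" "m > 0"
    and \<zeta>: "\<And>j. j \<in> {1..N} \<Longrightarrow> \<zeta> j \<in> {-1, 1}"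
    and sep: "\<And>i j t. \<lbrakk>i \<in> {1..N}; j \<in> {1..N}; i \<noteq> j; 0 \<le> t; t < T\<rbrakk> \<Longrightarrow> m \<le> \<bar>x i t - x j t\<bar>"
  obtains T' y where "T < T'" and "particle_solution \<gamma> s N \<zeta> x0 (ereal T') y"
    and "\<And>i t. t < T \<Longrightarrow> y i t = x i t"
proof -
  obtain g where g: "\<And>i. i \<in> {1..N} \<Longrightarrow> continuous_on {0..T} (g i)"
    "\<And>i t. \<lbrakk>i \<in> {1..N}; 0 \<le> t; t < T\<rbrakk> \<Longrightarrow> g i t = x i t"
    "\<And>i j. \<lbrakk>i \<in> {1..N}; j \<in> {1..N}; i \<noteq> j\<rbrakk> \<Longrightarrow> m \<le> \<bar>g i T - g j T\<bar>"
    using particle_solution_limits[OF assms] by blast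
  let ?L = "\<bar>\<gamma>\<bar> / (2 * s) * (N * (4 * s * (m / 2) powr (- 2 * s - 1)))"
  have pos: "m / 4 > 0" "?L \<ge> 0" using \<open>m > 0\<close> \<open>s > 0\<close> by auto
  have lip: "\<bar>particle_velocity \<gamma> s N \<zeta> Y i - particle_velocity \<gamma> s N \<zeta> Z i\<bar> \<le> ?L * D"
    if "i \<in> {1..N}" "\<And>j. j \<in> {1..N} \<Longrightarrow> \<bar>Y j - g j T\<bar> \<le> m / 4"
      "\<And>j. j \<in> {1..N} \<Longrightarrow> \<bar>Z j - g j T\<bar> \<le> m / 4" "\<And>j. j \<in> {1..N} \<Longrightarrow> \<bar>Y j - Z j\<bar> \<le> D"
    for Y Z D i
    by (rule particle_velocity_lipschitz[OF \<open>s > 0\<close> \<open>m > 0\<close> \<zeta> g(3) that(2-4,1)])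
  obtain \<delta> z where \<delta>: "\<delta> > 0" and z: "\<And>i. i \<in> {1..N} \<Longrightarrow> z i 0 = g i T"
    "\<And>i t. \<lbrakk>i \<in> {1..N}; t \<in> {0..\<delta>}\<rbrakk> \<Longrightarrow> \<bar>z i t - g i T\<bar> \<le> m / 4"
    "\<And>i t. \<lbrakk>i \<in> {1..N}; t \<in> {0..\<delta>}\<rbrakk> \<Longrightarrow>
       (z i has_real_derivative particle_velocity \<gamma> s N \<zeta> (\<lambda>j. z j t) i) (at t within {0..\<delta>})"
    by (rule picard_finite_index[of "{1..N}" "m / 4" ?L "\<lambda>i. g i T" "particle_velocity \<gamma> s N \<zeta>",
          OF finite_atLeastAtMost pos lip]) blast+
  \<comment> \<open>The inequality is strict because \<open>x i T\<close> is arbitrary; at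
    \<open>T\<close> the limit value \<open>z i 0 = g i T\<close> is taken.\<close>
  define y where "y = (\<lambda>i t. if t < T then x i t else z i (t - T))"
  have y_cont: "continuous_on {0..T + \<delta>} (y i)" if i: "i \<in> {1..N}" for i
  proof -
    have "continuous_on {0..T} (y i)"
      by (rule continuous_on_eq[OF g(1)[OF i]]) (use g(2) z(1) i in \<open>auto simp: y_def\<close>)
    moreover have "continuous_on {T..T + \<delta>} (\<lambda>t. z i (t - T))"
      using DERIV_continuous_on[OF z(3)[OF i]]
      by (rule continuous_on_compose2) (auto intro!: continuous_intros)
    then have "continuous_on {T..T + \<delta>} (y i)"
      by (rule continuous_on_eq) (auto simp: y_def)
    ultimately have "continuous_on ({0..T} \<union> {T..T + \<delta>}) (y i)"
      by (intro continuous_on_closed_Un) auto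
    moreover have "{0..T} \<union> {T..T + \<delta>} = {0..T + \<delta>}" using \<open>T > 0\<close> \<delta> by auto
    ultimately show ?thesis by simp
  qed
  have y_distinct: "y i t \<noteq> y j t" if ij: "i \<in> {1..N}" "j \<in> {1..N}" "i \<noteq> j" and t: "0 \<le> t" "t \<le> T + \<delta>" for i j t
  proof (cases "t < T")
    case True
    then show ?thesis using sol ij t by (auto simp: particle_solution_def y_def)
  next
    case False
    then have "t - T \<in> {0..\<delta>}" using t by auto
    \<comment> \<open>Two particles within \<open>m / 4\<close> of points at distance at least
      \<open>m\<close> cannot meet.\<close>
    from z(2)[OF ij(1) this] z(2)[OF ij(2) this] have "z i (t - T) \<noteq> z j (t - T)"
      using g(3)[OF ij] \<open>m > 0\<close> by linarith
    with False show ?thesis by (simp add: y_def)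
  qed
  let ?v = "\<lambda>i t. particle_velocity \<gamma> s N \<zeta> (\<lambda>j. y j t) i"
  have v_cont: "continuous_on {0..T + \<delta>} (?v i)" if "i \<in> {1..N}" for i
    by (rule continuous_on_particle_velocity) (use that y_cont y_distinct \<open>s > 0\<close> in auto)
  have y_deriv': "(y i has_real_derivative ?v i t) (at t)"
    if i: "i \<in> {1..N}" and t: "0 < t" "t < T + \<delta>" "t \<noteq> T" for i t
  proof (cases "t < T")
    case True
    then have "(x i has_real_derivative ?v i t) (at t)"
      using sol i t by (auto simp: particle_solution_def y_def)
    then show ?thesis
      by (rule has_field_derivative_transform_within_open[of _ _ _ "{..<T}"])
         (use True in \<open>auto simp: y_def\<close>)
  next
    case False
    then have t': "t - T \<in> {0..\<delta>}" "0 < t - T" "t - T < \<delta>" using t by auto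
    have "(z i has_real_derivative ?v i t) (at (t - T))"
      using z(3)[OF i t'(1)] False at_within_Icc_at[OF t'(2,3)] by (simp add: y_def)
    then have "((\<lambda>t. z i (t - T)) has_real_derivative ?v i t) (at t)"
      using DERIV_shift[of "z i" _ t "- T"] by simp
    then show ?thesis
      by (rule has_field_derivative_transform_within_open[of _ _ _ "{T<..}"])
         (use False t in \<open>auto simp: y_def\<close>)
  qed
  have y_deriv: "(y i has_real_derivative ?v i t) (at t)"
    if i: "i \<in> {1..N}" and t: "0 < t" "t < T + \<delta>" for i t
  proof (cases "t = T")
    case True
    have "(y i has_real_derivative ?v i T) (at T)"
      by (rule has_real_derivative_at_exceptional_point[of 0 T "T + \<delta>"])
         (use i \<delta> \<open>T > 0\<close> y_cont v_cont y_deriv' in auto)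
    with True show ?thesis by simp
  qed (use y_deriv' i t in auto)
  show thesis
  proof (rule that[of "T + \<delta>" y])
    show "particle_solution \<gamma> s N \<zeta> x0 (ereal (T + \<delta>)) y"
      unfolding particle_solution_def
    proof (intro conjI ballI allI impI)
      fix i assume i: "i \<in> {1..N}"
      show "y i 0 = x0 i" using sol i \<open>T > 0\<close> by (auto simp: particle_solution_def y_def)
      show "continuous_on {t. 0 \<le> t \<and> ereal t < ereal (T + \<delta>)} (y i)"
        by (rule continuous_on_subset[OF y_cont[OF i]]) auto
    qed (use y_distinct y_deriv in auto)
  qed (use \<delta> in \<open>auto simp: y_def\<close>)
qed

subsection \<open>A close pair of opposite orientation\<close>

text \<open>A snapshot at one time. The factor \<open>b\<close> is a parameter because the estimates
  serve twice: with the larger constant while closeness is being propagated, and with the smaller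
  one once it is established.\<close>

locale close_opposite_pair =
  fixes \<gamma> s :: real and N :: nat and \<zeta> X :: "nat \<Rightarrow> real" and i :: nat and b :: real
  assumes \<gamma>_pos: "\<gamma> > 0" and s_pos: "s > 0" and b_pos: "b > 0"
    and ordered: "strict_mono_on {1..N} X"
    and orientation: "\<And>j. j \<in> {1..N} \<Longrightarrow> \<zeta> j \<in> {-1, 1}"
    and index: "i \<in> {1..N - 1}"
    and opposite: "\<zeta> i * \<zeta> (Suc i) = -1"
    and close: "\<And>j. j \<in> {1..N - 1} - {i} \<Longrightarrow> gap X i \<le> b * gap X j"
begin

lemma index_in: "i \<in> {1..N}" "Suc i \<in> {1..N}"
  using index by auto

lemma gap_le_distance:
  assumes "k \<in> {1..N}" "l \<in> {1..N}" "k \<le> j" "j < l"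
  shows "gap X j \<le> X l - X k"
proof -
  have "X k \<le> X j" "X (Suc j) \<le> X l"
    using assms by (auto intro!: monotone_onD[OF strict_mono_on_imp_mono_on[OF ordered]])
  then show ?thesis by (simp add: gap_def)
qed

lemma gap_pos: "gap X i > 0"
  using strict_mono_onD[OF ordered index_in] by (simp add: gap_def)

text \<open>Two particles other than the pair itself always enclose a gap with index different from
  \<open>i\<close>, and that gap is at least \<open>gap X i / b\<close>.\<close>

lemma distance_ge:
  assumes "k \<in> {1..N}" "l \<in> {1..N}" "k \<noteq> l" "{k, l} \<noteq> {i, Suc i}"
  shows "gap X i / b \<le> \<bar>X k - X l\<bar>"
proof -
  have *: "gap X i / b \<le> X l - X k"
    if kl: "k \<in> {1..N}" "l \<in> {1..N}" "k < l" "{k, l} \<noteq> {i, Suc i}" for k l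
  proof -
    \<comment> \<open>For \<open>k = i\<close> the last enclosed gap is taken; its index differs
      from \<open>i\<close> because \<open>l \<noteq> Suc i\<close>.\<close>
    define j where "j = (if k = i then l - 1 else k)"
    have "j \<noteq> i" "k \<le> j" "j < l" using kl by (auto simp: j_def)
    moreover from this kl have "j \<in> {1..N - 1} - {i}" by auto
    ultimately show ?thesis
      using order.trans[OF close[of j] mult_left_mono[OF gap_le_distance[OF kl(1,2), of j], of b]] b_pos
      by (simp add: divide_le_eq mult.commute)
  qed
  show ?thesis
    using *[of k l] *[of l k] assms by (cases "k < l") (auto simp: insert_commute)
qed

definition force :: "nat \<Rightarrow> nat \<Rightarrow> real" where
  "force k l = \<zeta> k * \<zeta> l * pair_force s (X k - X l)"

lemma velocity_force:
  "particle_velocity \<gamma> s N \<zeta> X k = \<gamma> / (2 * s) * (\<Sum>l\<in>{1..N} - {k}. force k l)"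
  by (simp add: particle_velocity_pair_force force_def)

text \<open>Expresses the bound on distant forces in units of the attraction inside the pair, so
  that all forces can be compared.\<close>

lemma scaled_gap_powr: "(gap X i / b) powr (- 2 * s) = b powr (2 * s) * gap X i powr (- 2 * s)"
  using gap_pos b_pos by (simp add: powr_divide powr_minus field_simps)

lemma abs_force_le:
  assumes "k \<in> {1..N}" "l \<in> {1..N}" "k \<noteq> l" "{k, l} \<noteq> {i, Suc i}"
  shows "\<bar>force k l\<bar> \<le> b powr (2 * s) * gap X i powr (- 2 * s)"
proof -
  have "\<bar>\<zeta> k * \<zeta> l\<bar> = 1"
    using orientation[OF assms(1)] orientation[OF assms(2)] by (auto simp: abs_mult)
  then show ?thesis
    using abs_pair_force_le[OF s_pos _ distance_ge[OF assms]] gap_pos b_pos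
    unfolding scaled_gap_powr by (simp add: force_def abs_mult)
qed

lemma force_pair:
  "force i (Suc i) = gap X i powr (- 2 * s)" "force (Suc i) i = - (gap X i powr (- 2 * s))"
proof -
  have diff: "X i - X (Suc i) = - gap X i" "X (Suc i) - X i = gap X i" by (simp_all add: gap_def)
  show "force i (Suc i) = gap X i powr (- 2 * s)" "force (Suc i) i = - (gap X i powr (- 2 * s))"
    using opposite gap_pos
    by (simp_all only: force_def diff pair_force_minus pair_force_pos mult.commute[of "\<zeta> (Suc i)"])
qed

lemma sum_remaining_force:
  assumes "k \<in> {i, Suc i}"
  shows "\<bar>\<Sum>l\<in>{1..N} - {i, Suc i}. force k l\<bar>
    \<le> (real N - 2) * (b powr (2 * s) * gap X i powr (- 2 * s))"
proof -
  have "\<bar>\<Sum>l\<in>{1..N} - {i, Suc i}. force k l\<bar>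
      \<le> (\<Sum>l\<in>{1..N} - {i, Suc i}. b powr (2 * s) * gap X i powr (- 2 * s))"
    using assms index_in
    by (intro order.trans[OF sum_abs] sum_mono abs_force_le) auto
  moreover have "card ({1..N} - {i, Suc i}) = N - 2" "N \<ge> 2"
    using index_in by (auto simp: card_Diff_subset)
  ultimately show ?thesis by (simp add: of_nat_diff)
qed

text \<open>The mutual attraction acts on both ends and contributes \<open>- 2 * P\<close>; the
  remaining N - 2 forces contribute at most \<open>Q\<close> at each end. The prefactor
  \<open>\<gamma> / (2 * s)\<close> turns the common 2 into \<open>\<gamma> / s\<close>.\<close>

lemma gap_velocity_le:
  "particle_velocity \<gamma> s N \<zeta> X (Suc i) - particle_velocity \<gamma> s N \<zeta> X i
    \<le> - (\<gamma> / s * (1 - (real N - 2) * b powr (2 * s)) * gap X i powr (- 2 * s))"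
proof -
  have split: "(\<Sum>l\<in>{1..N} - {k}. force k l) = force k l + (\<Sum>l\<in>{1..N} - {i, Suc i}. force k l)"
    if "{k, l} = {i, Suc i}" "k \<noteq> l" for k l
  proof -
    have "{1..N} - {k} - {l} = {1..N} - {i, Suc i}" "l \<in> {1..N} - {k}"
      using that index_in by auto
    then show ?thesis by (metis finite_Diff finite_atLeastAtMost sum.remove)
  qed
  define P Q where "P = gap X i powr (- 2 * s)" and "Q = (real N - 2) * (b powr (2 * s) * P)"
  have "(\<Sum>l\<in>{1..N} - {Suc i}. force (Suc i) l) - (\<Sum>l\<in>{1..N} - {i}. force i l) \<le> - 2 * P + 2 * Q"
    using sum_remaining_force[of i] sum_remaining_force[of "Suc i"]
    by (subst split[of "Suc i" i], force, force, subst split[of i "Suc i"], force, force)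
       (simp add: force_pair P_def Q_def)
  then have "\<gamma> / (2 * s) * ((\<Sum>l\<in>{1..N} - {Suc i}. force (Suc i) l) - (\<Sum>l\<in>{1..N} - {i}. force i l))
      \<le> \<gamma> / (2 * s) * (- 2 * P + 2 * Q)"
    using \<gamma>_pos s_pos by (intro mult_left_mono) auto
  also have "\<dots> = - (\<gamma> / s * (1 - (real N - 2) * b powr (2 * s)) * P)"
    using s_pos by (simp add: Q_def field_simps)
  finally show ?thesis by (simp add: velocity_force right_diff_distrib P_def)
qed

text \<open>Only the two forces inside the pair can exceed \<open>B\<close> in modulus, and they
  have the favourable sign: since \<open>j \<noteq> i\<close>, particle \<open>i\<close> can only be
  the right end of gap \<open>j\<close>, which is pulled right, and \<open>Suc i\<close> only its
  left end, which is pulled left. All N - 1 forces at each end thus obey a one-sided bound.\<close>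

lemma other_gap_velocity_ge:
  assumes j: "j \<in> {1..N - 1} - {i}"
  shows "particle_velocity \<gamma> s N \<zeta> X (Suc j) - particle_velocity \<gamma> s N \<zeta> X j
    \<ge> - (\<gamma> / s * ((real N - 1) * b powr (2 * s)) * gap X i powr (- 2 * s))"
proof -
  define P B where "P = gap X i powr (- 2 * s)" and "B = b powr (2 * s) * P"
  have jN: "j \<in> {1..N}" "Suc j \<in> {1..N}" using j by auto
  have card: "real (card ({1..N} - {k})) = real N - 1" if "k \<in> {1..N}" for k
    using that by (simp add: of_nat_diff)
  have force_ge: "- B \<le> force k l" if "k \<in> {1..N}" "l \<in> {1..N}" "k \<noteq> l" "k \<noteq> Suc i" for k l
  proof (cases "k = i \<and> l = Suc i")
    case False
    with that abs_force_le[of k l] show ?thesis by (auto simp: B_def P_def doubleton_eq_iff)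
  next
    case True
    then have "0 \<le> force k l" by (simp add: force_pair)
    moreover have "0 \<le> B" by (simp add: B_def P_def)
    ultimately show ?thesis by linarith
  qed
  have force_le: "force k l \<le> B" if "k \<in> {1..N}" "l \<in> {1..N}" "k \<noteq> l" "k \<noteq> i" for k l
  proof (cases "k = Suc i \<and> l = i")
    case False
    with that abs_force_le[of k l] show ?thesis by (auto simp: B_def P_def doubleton_eq_iff)
  next
    case True
    then have "force k l \<le> 0" by (simp add: force_pair)
    moreover have "0 \<le> B" by (simp add: B_def P_def)
    ultimately show ?thesis by linarith
  qed
  have "(\<Sum>l\<in>{1..N} - {j}. force j l) \<le> (\<Sum>l\<in>{1..N} - {j}. B)"
    using force_le jN j by (intro sum_mono) auto
  moreover have "(\<Sum>l\<in>{1..N} - {Suc j}. - B) \<le> (\<Sum>l\<in>{1..N} - {Suc j}. force (Suc j) l)"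
    using force_ge jN j by (intro sum_mono) auto
  ultimately have "- 2 * ((real N - 1) * B)
      \<le> (\<Sum>l\<in>{1..N} - {Suc j}. force (Suc j) l) - (\<Sum>l\<in>{1..N} - {j}. force j l)"
    using card[OF jN(1)] card[OF jN(2)] by simp
  then have "\<gamma> / (2 * s) * (- 2 * ((real N - 1) * B))
      \<le> \<gamma> / (2 * s) * ((\<Sum>l\<in>{1..N} - {Suc j}. force (Suc j) l) - (\<Sum>l\<in>{1..N} - {j}. force j l))"
    using \<gamma>_pos s_pos by (intro mult_left_mono) auto
  moreover have "\<gamma> / (2 * s) * (- 2 * ((real N - 1) * B)) = - (\<gamma> / s * ((real N - 1) * b powr (2 * s)) * P)"
    using s_pos by (simp add: B_def field_simps)
  ultimately show ?thesis
    unfolding velocity_force right_diff_distrib[symmetric] P_def[symmetric] by linarith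
qed

end

subsection \<open>Evolution of the gap\<close>

text \<open>Take the supremum \<open>c\<close> of the times up to which \<open>P\<close> has held
  throughout. Closedness gives \<open>P\<close> at \<open>c\<close>, and \<open>step\<close> would
  carry it past \<open>c\<close> if \<open>c < b\<close>.\<close>

lemma interval_induction:
  fixes a b :: real
  assumes "a \<le> b" and closed: "closed {t \<in> {a..b}. P t}" and "P a"
    and step: "\<And>t. \<lbrakk>a \<le> t; t < b; P t\<rbrakk> \<Longrightarrow> \<exists>\<epsilon>>0. \<forall>\<tau>\<in>{t..t + \<epsilon>}. \<tau> \<le> b \<longrightarrow> P \<tau>"
  shows "P b"
proof -
  define S where "S = {t \<in> {a..b}. \<forall>\<tau>\<in>{a..t}. P \<tau>}"
  define c where "c = Sup S"
  have "a \<in> S" using assms by (auto simp: S_def)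
  have bdd: "bdd_above S" by (auto simp: S_def intro: bdd_aboveI[of _ b])
  have "a \<le> c" unfolding c_def by (rule cSup_upper[OF \<open>a \<in> S\<close> bdd])
  moreover have "t \<le> b" if "t \<in> S" for t using that by (simp add: S_def)
  then have "c \<le> b" unfolding c_def by (intro cSup_least) (use \<open>a \<in> S\<close> in auto)
  ultimately have c: "a \<le> c" "c \<le> b" .
  have below: "P \<tau>" if "a \<le> \<tau>" "\<tau> < c" for \<tau>
  proof -
    from that \<open>a \<in> S\<close> obtain t where "t \<in> S" "\<tau> < t"
      unfolding c_def by (blast elim: less_cSupE)
    with that show ?thesis by (auto simp: S_def)
  qed
  have "P c"
  proof (cases "a = c")
    case False
    have "closure {a..<c} \<subseteq> {t \<in> {a..b}. P t}"
      using c below by (intro closure_minimal closed) auto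
    with False c show ?thesis by auto
  qed (use \<open>P a\<close> in simp)
  have "c = b"
  proof (rule ccontr)
    assume "c \<noteq> b"
    with c have "c < b" by simp
    from step[OF c(1) this \<open>P c\<close>] obtain \<epsilon>
      where \<epsilon>: "\<epsilon> > 0" "\<forall>\<tau>\<in>{c..c + \<epsilon>}. \<tau> \<le> b \<longrightarrow> P \<tau>" by blast
    \<comment> \<open>The truncation at \<open>b\<close> is needed since \<open>step\<close>
      promises nothing beyond \<open>b\<close>.\<close>
    have "min b (c + \<epsilon>) \<in> S"
    proof -
      have "P \<tau>" if "a \<le> \<tau>" "\<tau> \<le> b" "\<tau> \<le> c + \<epsilon>" for \<tau>
        using that \<epsilon>(2) below[of \<tau>] by (cases "\<tau> < c") auto
      then show ?thesis using c \<epsilon>(1) by (auto simp: S_def)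
    qed
    then have "min b (c + \<epsilon>) \<le> c" unfolding c_def by (intro cSup_upper bdd)
    with \<open>\<epsilon> > 0\<close> \<open>c < b\<close> show False by linarith
  qed
  with \<open>P c\<close> show ?thesis by simp
qed

text \<open>The slack between \<open>a\<close> and \<open>b\<close> makes the closeness condition open, so that it persists
  for a short time and the gap inequality with factor \<open>a\<close> can be propagated.\<close>

locale close_opposite_flow =
  fixes \<gamma> s :: real and N :: nat and \<zeta> x0 :: "nat \<Rightarrow> real" and T :: ereal
    and x :: "nat \<Rightarrow> real \<Rightarrow> real" and i :: nat and a b :: real
  assumes \<gamma>_pos: "\<gamma> > 0" and s_pos: "s > 0" and a_pos: "a > 0" and a_less_b: "a < b"
    and small: "(real N - 2 + a * (real N - 1)) * b powr (2 * s) < 1"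
    and ordered0: "strict_mono_on {1..N} x0"
    and orientation: "\<And>j. j \<in> {1..N} \<Longrightarrow> \<zeta> j \<in> {-1, 1}"
    and index: "i \<in> {1..N - 1}"
    and opposite: "\<zeta> i * \<zeta> (Suc i) = -1"
    and close0: "\<And>j. j \<in> {1..N - 1} - {i} \<Longrightarrow> gap x0 i \<le> a * gap x0 j"
    and sol: "particle_solution \<gamma> s N \<zeta> x0 T x"
begin

section \<open>Positions and gaps along a solution\<close>

definition gap_at :: "nat \<Rightarrow> real \<Rightarrow> real" where
  "gap_at j t = gap (\<lambda>k. x k t) j"

abbreviation gap_speed :: "nat \<Rightarrow> real \<Rightarrow> real" where
  "gap_speed j t \<equiv> particle_velocity \<gamma> s N \<zeta> (\<lambda>k. x k t) (Suc j)
     - particle_velocity \<gamma> s N \<zeta> (\<lambda>k. x k t) j"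

lemma at_zero: "j \<in> {1..N} \<Longrightarrow> x j 0 = x0 j"
  using sol by (auto simp: particle_solution_def)

lemma gap_at_zero: "j \<in> {1..N - 1} \<Longrightarrow> gap_at j 0 = gap x0 j"
  using at_zero[of j] at_zero[of "Suc j"] by (auto simp: gap_at_def gap_def)

lemma continuous_on_position:
  assumes "j \<in> {1..N}" "ereal t < T" shows "continuous_on {0..t} (x j)"
proof (rule continuous_on_subset)
  show "continuous_on {t. 0 \<le> t \<and> ereal t < T} (x j)"
    using sol assms(1) unfolding particle_solution_def by blast
  show "{0..t} \<subseteq> {t. 0 \<le> t \<and> ereal t < T}"
    using assms(2) by (auto intro: le_less_trans[rotated])
qed

lemma continuous_on_gap_at:
  assumes "j \<in> {1..N - 1}" "ereal t < T" shows "continuous_on {0..t} (gap_at j)"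
  unfolding gap_at_def gap_def
  by (intro continuous_intros continuous_on_position) (use assms in auto)

lemma gap_at_deriv:
  assumes "j \<in> {1..N - 1}" "0 < t" "ereal t < T"
  shows "(gap_at j has_real_derivative gap_speed j t) (at t)"
proof -
  have "(x k has_real_derivative particle_velocity \<gamma> s N \<zeta> (\<lambda>k. x k t) k) (at t)"
    if "k \<in> {1..N}" for k
    using sol that assms(2,3) unfolding particle_solution_def by blast
  then show ?thesis
    unfolding gap_at_def gap_def by (intro DERIV_diff) (use assms(1) in auto)
qed

text \<open>A difference of positions that changed sign would vanish at some earlier time, and
  collisions are excluded before \<open>T\<close>.\<close>

lemma ordered_at:
  assumes t: "0 \<le> t" "ereal t < T"
  shows "strict_mono_on {1..N} (\<lambda>k. x k t)"
proof (rule strict_mono_onI, rule ccontr)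
  fix k l assume kl: "k \<in> {1..N}" "l \<in> {1..N}" "k < l" "\<not> x k t < x l t"
  have "x l 0 - x k 0 > 0"
    using strict_mono_onD[OF ordered0 kl(1-3)] at_zero kl by simp
  moreover have "continuous_on {0..t} (\<lambda>t. x l t - x k t)"
    by (intro continuous_intros continuous_on_position kl t)
  ultimately obtain \<tau> where \<tau>: "0 \<le> \<tau>" "\<tau> \<le> t" "x l \<tau> - x k \<tau> = 0"
    using IVT2'[of "\<lambda>t. x l t - x k t" t 0 0] t kl by auto
  then have "ereal \<tau> < T" using t le_less_trans[of "ereal \<tau>" "ereal t" T] by simp
  with \<tau> kl sol show False unfolding particle_solution_def by (metis eq_iff_diff_eq_0 less_irrefl)
qed

lemma pair_at:
  assumes "0 \<le> t" "ereal t < T" "c > 0"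
    and "\<And>j. j \<in> {1..N - 1} - {i} \<Longrightarrow> gap_at i t \<le> c * gap_at j t"
  shows "close_opposite_pair \<gamma> s N \<zeta> (\<lambda>k. x k t) i c"
  using assms ordered_at orientation \<gamma>_pos s_pos index opposite
  unfolding gap_at_def by unfold_locales auto

lemma gap_at_pos: "0 \<le> t \<Longrightarrow> ereal t < T \<Longrightarrow> j \<in> {1..N - 1} \<Longrightarrow> gap_at j t > 0"
  using strict_mono_onD[OF ordered_at, of t j "Suc j"] by (auto simp: gap_at_def gap_def)

text \<open>The two velocity bounds add up to a negative multiple of
  \<open>1 - (N - 2 + a * (N - 1)) * b powr (2 * s)\<close>, which is positive by
  \<open>small\<close>.\<close>

lemma relative_gap_speed_nonpos:
  assumes t: "0 \<le> t" "ereal t < T" and j: "j \<in> {1..N - 1} - {i}"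
    and near: "\<And>k. k \<in> {1..N - 1} - {i} \<Longrightarrow> gap_at i t \<le> b * gap_at k t"
  shows "gap_speed i t - a * gap_speed j t \<le> 0"
proof -
  have "b > 0" using a_pos a_less_b by simp
  then interpret pair: close_opposite_pair \<gamma> s N \<zeta> "\<lambda>k. x k t" i b
    by (intro pair_at t near)
  define B P where "B = b powr (2 * s)" and "P = gap (\<lambda>k. x k t) i powr (- 2 * s)"
  have "gap_speed i t - a * gap_speed j t
      \<le> - (\<gamma> / s * (1 - (real N - 2) * B) * P) - a * (- (\<gamma> / s * ((real N - 1) * B) * P))"
    unfolding B_def P_def
    using a_pos by (intro diff_mono mult_left_mono pair.gap_velocity_le pair.other_gap_velocity_ge j) auto
  also have "\<dots> = - (\<gamma> / s * P * (1 - (real N - 2 + a * (real N - 1)) * B))"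
    using s_pos by (simp add: field_simps)
  also have "\<dots> \<le> 0"
    using small \<gamma>_pos s_pos by (simp add: B_def P_def)
  finally show ?thesis .
qed

lemma stays_close:
  assumes t: "0 \<le> t" "ereal t < T" and j: "j \<in> {1..N - 1} - {i}"
  shows "gap_at i t \<le> a * gap_at j t"
proof -
  let ?J = "{1..N - 1} - {i}"
  have T: "ereal \<tau> < T" if "\<tau> \<le> t" for \<tau>
    using that t le_less_trans[of "ereal \<tau>" "ereal t" T] by simp
  have cont: "continuous_on {0..t} (gap_at k)" if "k \<in> {1..N - 1}" for k
    by (rule continuous_on_gap_at[OF that t(2)])
  have "\<forall>j\<in>?J. gap_at i t \<le> a * gap_at j t"
  proof (rule interval_induction[OF \<open>0 \<le> t\<close>, where P = "\<lambda>t. \<forall>j\<in>?J. gap_at i t \<le> a * gap_at j t"])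
    have "{\<tau> \<in> {0..t}. \<forall>j\<in>?J. gap_at i \<tau> \<le> a * gap_at j \<tau>}
        = {0..t} \<inter> (\<Inter>j\<in>?J. {\<tau> \<in> {0..t}. gap_at i \<tau> \<le> a * gap_at j \<tau>})" by auto
    also have "closed \<dots>"
      by (intro closed_Int closed_INT ballI continuous_on_closed_Collect_le continuous_intros cont)
         (use index in auto)
    finally show "closed {\<tau> \<in> {0..t}. \<forall>j\<in>?J. gap_at i \<tau> \<le> a * gap_at j \<tau>}" .
    show "\<forall>j\<in>?J. gap_at i 0 \<le> a * gap_at j 0"
      using close0 gap_at_zero index by auto
  next
    fix \<tau> assume \<tau>: "0 \<le> \<tau>" "\<tau> < t" and near: "\<forall>j\<in>?J. gap_at i \<tau> \<le> a * gap_at j \<tau>"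
    have "\<forall>\<^sub>F r in at \<tau> within {0..t}. \<forall>j\<in>?J. 0 < b * gap_at j r - gap_at i r"
    proof (intro eventually_ball_finite ballI)
      fix j assume j: "j \<in> ?J"
      have "continuous_on {0..t} (\<lambda>r. b * gap_at j r - gap_at i r)"
        by (intro continuous_intros cont) (use index j in auto)
      then have "((\<lambda>r. b * gap_at j r - gap_at i r) \<longlongrightarrow> b * gap_at j \<tau> - gap_at i \<tau>) (at \<tau> within {0..t})"
        using \<tau> by (auto simp: continuous_on_def)
      moreover have "a * gap_at j \<tau> < b * gap_at j \<tau>"
        using a_less_b gap_at_pos[of \<tau> j] \<tau> T[of \<tau>] j by simp
      then have "0 < b * gap_at j \<tau> - gap_at i \<tau>" using bspec[OF near j] by linarith
      ultimately show "\<forall>\<^sub>F r in at \<tau> within {0..t}. 0 < b * gap_at j r - gap_at i r"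
        by (rule order_tendstoD)
    qed simp
    then obtain d where d: "d > 0" and
      near': "\<And>r j. \<lbrakk>r \<in> {0..t}; r \<noteq> \<tau>; dist r \<tau> < d; j \<in> ?J\<rbrakk> \<Longrightarrow> 0 < b * gap_at j r - gap_at i r"
      unfolding eventually_at by blast
    \<comment> \<open>Half of \<open>d\<close> keeps the closed interval inside the open
      neighbourhood. There closeness with factor \<open>b\<close> holds, so
      \<open>\<theta> i - a * \<theta> j\<close> cannot increase from its nonpositive value at
      \<open>\<tau>\<close>.\<close>
    have "gap_at i r \<le> a * gap_at j r" if r: "r \<in> {\<tau>..\<tau> + d / 2}" "r \<le> t" and j: "j \<in> ?J" for r j
    proof -
      have "gap_at i r - a * gap_at j r \<le> gap_at i \<tau> - a * gap_at j \<tau>"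
      proof (rule DERIV_nonpos_imp_decreasing_open[where f = "\<lambda>r. gap_at i r - a * gap_at j r"])
        fix q assume q: "\<tau> < q" "q < r"
        then have q': "0 < q" "ereal q < T" using \<tau> r T by auto
        have "((\<lambda>r. gap_at i r - a * gap_at j r) has_real_derivative gap_speed i q - a * gap_speed j q) (at q)"
          by (intro DERIV_diff DERIV_cmult gap_at_deriv q') (use index j in auto)
        moreover have "gap_speed i q - a * gap_speed j q \<le> 0"
        proof (rule relative_gap_speed_nonpos[OF _ q'(2) j])
          fix k assume "k \<in> ?J"
          then show "gap_at i q \<le> b * gap_at k q"
            using near'[of q k] q r \<tau> d by (auto simp: dist_real_def)
        qed (use q' in simp)
        ultimately show "\<exists>y. ((\<lambda>r. gap_at i r - a * gap_at j r) has_real_derivative y) (at q) \<and> y \<le> 0"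
          by blast
      next
        have "continuous_on {0..t} (\<lambda>r. gap_at i r - a * gap_at j r)"
          by (intro continuous_intros cont) (use index j in auto)
        then show "continuous_on {\<tau>..r} (\<lambda>r. gap_at i r - a * gap_at j r)"
          by (rule continuous_on_subset) (use \<tau> r in auto)
      qed (use r in simp)
      then show ?thesis using bspec[OF near j] by linarith
    qed
    then show "\<exists>\<epsilon>>0. \<forall>r\<in>{\<tau>..\<tau> + \<epsilon>}. r \<le> t \<longrightarrow> (\<forall>j\<in>?J. gap_at i r \<le> a * gap_at j r)"
      using d by (intro exI[of _ "d / 2"]) auto
  qed
  with j show ?thesis by blast
qed

section \<open>Decay of the gap and the bound on the lifetime\<close>

lemma pair_at_time:
  assumes "0 \<le> t" "ereal t < T"
  shows "close_opposite_pair \<gamma> s N \<zeta> (\<lambda>k. x k t) i a"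
  by (intro pair_at assms a_pos stays_close)

text \<open>A lower bound for the share of the attraction that survives the N - 2 outside forces. It
  is formed with \<open>a\<close>, since closeness with that factor is now available at all
  times.\<close>

definition \<kappa> :: real where
  "\<kappa> = 1 - (real N - 2) * a powr (2 * s)"

lemma \<kappa>_pos: "\<kappa> > 0"
proof -
  have N: "real N - 2 \<ge> 0" "real N - 1 \<ge> 0" using index by auto
  have "(real N - 2) * a powr (2 * s) \<le> (real N - 2) * b powr (2 * s)"
    using a_pos a_less_b s_pos N by (intro mult_left_mono powr_mono2) auto
  also have "\<dots> \<le> (real N - 2 + a * (real N - 1)) * b powr (2 * s)"
    using a_pos N by (intro mult_right_mono) auto
  finally show ?thesis using small by (simp add: \<kappa>_def)
qed

lemma gap_speed_le:
  assumes "0 \<le> t" "ereal t < T"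
  shows "gap_speed i t \<le> - (\<gamma> / s * \<kappa> * gap_at i t powr (- 2 * s))"
  using close_opposite_pair.gap_velocity_le[OF pair_at_time[OF assms]]
  by (simp add: \<kappa>_def gap_at_def)

lemma gap_at_antimono:
  assumes "0 \<le> r" "r \<le> t" "ereal t < T"
  shows "gap_at i t \<le> gap_at i r"
proof (rule DERIV_nonpos_imp_decreasing_open[OF \<open>r \<le> t\<close>, where f = "gap_at i"])
  fix q assume "r < q" "q < t"
  then have q: "0 < q" "ereal q < T"
    using assms le_less_trans[of "ereal q" "ereal t" T] by auto
  have "0 \<le> \<gamma> / s * \<kappa> * gap_at i q powr (- 2 * s)"
    using \<gamma>_pos s_pos \<kappa>_pos by simp
  then have "gap_speed i q \<le> 0" using gap_speed_le[of q] q by linarith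
  then show "\<exists>y. (gap_at i has_real_derivative y) (at q) \<and> y \<le> 0"
    using gap_at_deriv[OF index q] by blast
next
  show "continuous_on {r..t} (gap_at i)"
    using continuous_on_gap_at[OF index assms(3)] by (rule continuous_on_subset) (use assms in auto)
qed

text \<open>Multiplying \<open>gap_speed_le\<close> by \<open>(2 * s + 1) * g powr (2 * s)\<close>
  cancels the singular power and leaves a constant. Adding the linear term \<open>M * t\<close>
  turns the estimate into monotonicity of a single function.\<close>

lemma gap_power_decay:
  assumes t: "0 \<le> t" "ereal t < T"
  shows "gap_at i t powr (2 * s + 1) + (2 * s + 1) * (\<gamma> / s) * \<kappa> * t \<le> gap x0 i powr (2 * s + 1)"
proof -
  define M where "M = (2 * s + 1) * (\<gamma> / s) * \<kappa>"
  have T: "ereal q < T" if "q \<le> t" for q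
    using that t le_less_trans[of "ereal q" "ereal t" T] by simp
  have "gap_at i t powr (2 * s + 1) + M * t \<le> gap_at i 0 powr (2 * s + 1) + M * 0"
  proof (rule DERIV_nonpos_imp_decreasing_open[OF \<open>0 \<le> t\<close>,
        where f = "\<lambda>t. gap_at i t powr (2 * s + 1) + M * t"])
    fix q assume "0 < q" "q < t"
    then have q: "0 < q" "ereal q < T" using T by auto
    define g where "g = gap_at i q"
    have g: "g > 0" unfolding g_def using q index by (intro gap_at_pos) auto
    have "((\<lambda>t. gap_at i t powr (2 * s + 1)) has_real_derivative
        (2 * s + 1) * g powr (2 * s + 1 - 1) * gap_speed i q) (at q)"
      unfolding g_def
      by (rule DERIV_chain2[OF has_real_derivative_powr gap_at_deriv[OF index q]])
         (use g in \<open>simp add: g_def\<close>)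
    from DERIV_add[OF this DERIV_cmult[OF DERIV_ident, of M]]
    have deriv: "((\<lambda>t. gap_at i t powr (2 * s + 1) + M * t) has_real_derivative
        (2 * s + 1) * g powr (2 * s + 1 - 1) * gap_speed i q + M * 1) (at q)" .
    have "(2 * s + 1) * g powr (2 * s + 1 - 1) * gap_speed i q
        \<le> (2 * s + 1) * g powr (2 * s + 1 - 1) * - (\<gamma> / s * \<kappa> * g powr (- 2 * s))"
      unfolding g_def using s_pos q by (intro mult_left_mono gap_speed_le) auto
    moreover have "g powr (2 * s) * g powr (- 2 * s) = 1"
      using g by (simp flip: powr_add)
    then have "(2 * s + 1) * g powr (2 * s + 1 - 1) * - (\<gamma> / s * \<kappa> * g powr (- 2 * s)) = - M"
      by (simp add: M_def)
    ultimately have "(2 * s + 1) * g powr (2 * s + 1 - 1) * gap_speed i q + M * 1 \<le> 0" by linarith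
    with deriv show "\<exists>y. ((\<lambda>t. gap_at i t powr (2 * s + 1) + M * t) has_real_derivative y) (at q) \<and> y \<le> 0"
      by blast
  next
    have "gap_at i q \<noteq> 0" if "q \<in> {0..t}" for q
      using gap_at_pos[of q i] T[of q] that index by auto
    then show "continuous_on {0..t} (\<lambda>t. gap_at i t powr (2 * s + 1) + M * t)"
      by (intro continuous_intros continuous_on_gap_at index t) auto
  qed
  then show ?thesis using gap_at_zero[OF index] by (simp add: M_def)
qed

text \<open>At the time \<open>\<tau>\<close> the linear term has used up the whole initial power,
  so a solution alive at \<open>\<tau>\<close> would have a gap that is both positive and
  zero.\<close>

lemma lifetime_le:
  "T \<le> ereal (s * gap x0 i powr (2 * s + 1) / ((2 * s + 1) * \<gamma> * \<kappa>))"
proof (rule ccontr)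
  define \<tau> where "\<tau> = s * gap x0 i powr (2 * s + 1) / ((2 * s + 1) * \<gamma> * \<kappa>)"
  assume "\<not> T \<le> ereal (s * gap x0 i powr (2 * s + 1) / ((2 * s + 1) * \<gamma> * \<kappa>))"
  then have "ereal \<tau> < T" by (simp add: \<tau>_def)
  moreover have "0 \<le> \<tau>" unfolding \<tau>_def using s_pos \<gamma>_pos \<kappa>_pos by simp
  moreover have "(2 * s + 1) * (\<gamma> / s) * \<kappa> * \<tau> = gap x0 i powr (2 * s + 1)"
  proof -
    define D where "D = (2 * s + 1) * \<gamma> * \<kappa>"
    have "D > 0" using s_pos \<gamma>_pos \<kappa>_pos by (simp add: D_def)
    then have "D * \<tau> / s = gap x0 i powr (2 * s + 1)"
      using s_pos by (simp add: \<tau>_def flip: D_def)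
    then show ?thesis by (simp add: D_def)
  qed
  ultimately have "gap_at i \<tau> powr (2 * s + 1) \<le> 0" "gap_at i \<tau> > 0"
    using gap_power_decay[of \<tau>] gap_at_pos[of \<tau> i] index by auto
  then show False by simp
qed

lemma gap_tendsto_zero:
  assumes "maximal_particle_solution \<gamma> s N \<zeta> x0 T x" and T: "T = ereal C" and "a \<le> 1"
  shows "(gap_at i \<longlongrightarrow> 0) (at_left C)"
proof -
  have "C > 0" using assms by (simp add: maximal_particle_solution_def)
  have "\<forall>\<^sub>F t in at_left C. \<bar>gap_at i t\<bar> < e" if "e > 0" for e
  proof (cases "\<exists>r\<ge>0. r < C \<and> gap_at i r < e")
    case True
    then obtain r where r: "0 \<le> r" "r < C" "gap_at i r < e" by blast
    \<comment> \<open>The gap never increases, so a single time with value below \<open>e\<close>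
      settles all later ones.\<close>
    show ?thesis
      using eventually_at_left_real[OF r(2)]
    proof eventually_elim
      case (elim t)
      then show ?case
        using gap_at_antimono[of r t] gap_at_pos[of t i] r index T by auto
    qed
  next
    case False
    have "e \<le> \<bar>x k t - x l t\<bar>"
      if kl: "k \<in> {1..N}" "l \<in> {1..N}" "k \<noteq> l" and t: "0 \<le> t" "t < C" for k l t
    proof -
      have e: "e \<le> gap_at i t" using False t by auto
      show ?thesis
      proof (cases "{k, l} = {i, Suc i}")
        case True
        with e show ?thesis by (auto simp: gap_at_def gap_def doubleton_eq_iff)
      next
        case False
        \<comment> \<open>With \<open>a \<le> 1\<close>, the lower bound \<open>e\<close> for the
          pair serves for all other distances as well.\<close>
        have "e * a \<le> e" using \<open>a \<le> 1\<close> \<open>e > 0\<close> by simp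
        then have "e \<le> gap_at i t / a" using e a_pos by (simp add: le_divide_eq)
        also have "\<dots> \<le> \<bar>x k t - x l t\<bar>"
          using close_opposite_pair.distance_ge[OF pair_at_time kl False] t T by (simp add: gap_at_def)
        finally show ?thesis .
      qed
    qed
    from particle_solution_extends[OF sol[unfolded T] \<open>C > 0\<close> s_pos \<open>e > 0\<close> orientation this]
    obtain C' y where "C < C'" "particle_solution \<gamma> s N \<zeta> x0 (ereal C') y"
      "\<And>k t. t < C \<Longrightarrow> y k t = x k t" by blast
    then have "\<exists>T' y. T < T' \<and> particle_solution \<gamma> s N \<zeta> x0 T' y \<and>
        (\<forall>i\<in>{1..N}. \<forall>t. 0 \<le> t \<and> ereal t < T \<longrightarrow> y i t = x i t)"
      unfolding T by (intro exI[of _ "ereal C'"] exI[of _ y]) simp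
    then show ?thesis using assms(1) unfolding maximal_particle_solution_def by blast
  qed
  then show ?thesis by (intro tendstoI) (simp add: dist_real_def)
qed

end

section \<open>Extended-real minima, positivity of \<gamma>, choice of the constants\<close>

lemma le_mult_min_other_gap_iff:
  assumes "a > 0"
  shows "ereal g \<le> ereal a * min_other_gap N X i \<longleftrightarrow> (\<forall>j\<in>{1..N - 1} - {i}. g \<le> a * gap X j)"
proof -
  \<comment> \<open>This includes \<open>y = \<infinity>\<close>, the minimum for
    \<open>N = 2\<close>: as \<open>a > 0\<close>, the product stays infinite.\<close>
  have *: "ereal g \<le> ereal a * y \<longleftrightarrow> ereal (g / a) \<le> y" for y
    using assms by (cases y) (auto simp: divide_le_eq mult.commute)
  show ?thesis
    by (subst *) (use assms in \<open>simp add: min_other_gap_def le_INF_iff divide_le_eq mult.commute\<close>)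
qed

text \<open>The integrand is positive everywhere, so a vanishing integral would make the whole line
  a null set. Integrability rules out the value 0 by convention.\<close>

lemma layer_gamma_pos:
  assumes "layer_solution s W u" "integrable lborel (\<lambda>y. (deriv u y)\<^sup>2)"
  shows "layer_gamma u > 0"
proof -
  have pos: "deriv u y > 0" for y using assms(1) by (simp add: layer_solution_def)
  have "(LINT y|lborel. (deriv u y)\<^sup>2) \<noteq> 0"
  proof
    assume "(LINT y|lborel. (deriv u y)\<^sup>2) = 0"
    then have "AE y in lborel. (deriv u y)\<^sup>2 = 0"
      using integral_nonneg_eq_0_iff_AE[OF assms(2)] by simp
    then have "AE y :: real in lborel. False"
      by (rule eventually_mono) (use pos in \<open>simp add: less_imp_neq[symmetric]\<close>)
    then show False by (simp add: ae_filter_eq_bot_iff)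
  qed
  moreover have "(LINT y|lborel. (deriv u y)\<^sup>2) \<ge> 0" by (rule Bochner_Integration.integral_nonneg) simp
  ultimately have "(LINT y|lborel. (deriv u y)\<^sup>2) > 0" by linarith
  then show ?thesis by (simp add: layer_gamma_def)
qed

theorem theorem1p5:
  fixes s :: real and N K :: nat
  assumes "0 < s" and "s < 1" and "N \<ge> 2" and "K \<ge> 1"
  shows "\<exists>a0::real. 0 < a0 \<and> a0 < 1 \<and>
    (\<forall>(W :: real \<Rightarrow> real) (u :: real \<Rightarrow> real) (\<gamma> :: real)
      (x0 :: nat \<Rightarrow> real) (\<zeta> :: nat \<Rightarrow> real)
      (Tc :: ereal) (x :: nat \<Rightarrow> real \<Rightarrow> real) (i :: nat).
      multiwell_potential W \<longrightarrow>
      layer_solution s W u \<longrightarrow>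
      integrable lborel (\<lambda>y. (deriv u y)\<^sup>2) \<longrightarrow>
      \<gamma> = layer_gamma u \<longrightarrow>
      strict_mono_on {1..N} x0 \<longrightarrow>
      (\<forall>j\<in>{1..N}. \<zeta> j \<in> {-1, 1}) \<longrightarrow>
      card {j\<in>{1..N}. \<zeta> j = -1} = K \<longrightarrow>
      maximal_particle_solution \<gamma> s N \<zeta> x0 Tc x \<longrightarrow>
      i \<in> {1..N-1} \<longrightarrow>
      \<zeta> i * \<zeta> (i + 1) = -1 \<longrightarrow>
      ereal (gap x0 i) \<le> ereal a0 * min_other_gap N x0 i \<longrightarrow>
        (\<forall>t. 0 < t \<and> ereal t < Tc \<longrightarrow>
           ereal (gap (\<lambda>j. x j t) i) \<le> ereal a0 * min_other_gap N (\<lambda>j. x j t) i) \<and>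
        Tc < \<infinity> \<and>
        ((\<lambda>t. gap (\<lambda>j. x j t) i) \<longlongrightarrow> 0) (at_left (real_of_ereal Tc)) \<and>
        Tc \<le> ereal (s * gap x0 i powr (2 * s + 1) /
               ((2 * s + 1) * \<gamma> * (1 - (real N - 2) * a0 powr (2 * s)))))"
proof -
  \<comment> \<open>The exponent makes the powers \<open>2 * s\<close> equal to
    \<open>1 / (4 * N)\<close> and \<open>1 / (2 * N)\<close>. Both constants depend on
    \<open>s\<close> and \<open>N\<close> alone, so they are fixed before the orientations and the
    initial points.\<close>
  define a b where "a = (4 * real N) powr (- (1 / (2 * s)))" and "b = (2 * real N) powr (- (1 / (2 * s)))"
  have N: "real N \<ge> 2" using \<open>N \<ge> 2\<close> by simp
  have a: "0 < a" "a < 1"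
    using N \<open>0 < s\<close> by (auto simp: a_def intro!: powr_less_one)
  have ab: "a < b"
    unfolding a_def b_def using N \<open>0 < s\<close> by (intro powr_less_mono2_neg) auto
  have "- (1 / (2 * s)) * (2 * s) = - 1" using \<open>0 < s\<close> by simp
  then have "b powr (2 * s) = 1 / (2 * real N)"
    unfolding b_def powr_powr using N by (simp only: powr_minus_divide) simp
  \<comment> \<open>As \<open>a < 1\<close>, the bracket is at most 2N - 3, below the 2N supplied by
    \<open>b\<close>.\<close>
  moreover have "a * (real N - 1) \<le> real N - 1"
    using a N by (intro mult_left_le_one_le) auto
  then have "real N - 2 + a * (real N - 1) < 2 * real N" using N by linarith
  then have "(real N - 2 + a * (real N - 1)) / (2 * real N) < 1" using N by (simp only: divide_less_eq_1_pos)
  ultimately have small: "(real N - 2 + a * (real N - 1)) * b powr (2 * s) < 1" by simp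
  show ?thesis
  proof (intro exI[of _ a] conjI[OF a(1)] conjI[OF a(2)] allI impI)
    fix W u :: "real \<Rightarrow> real" and \<gamma> :: real and x0 \<zeta> :: "nat \<Rightarrow> real" and Tc :: ereal
      and x :: "nat \<Rightarrow> real \<Rightarrow> real" and i :: nat
    assume layer: "layer_solution s W u" "integrable lborel (\<lambda>y. (deriv u y)\<^sup>2)" "\<gamma> = layer_gamma u"
      and x0: "strict_mono_on {1..N} x0" and \<zeta>: "\<forall>j\<in>{1..N}. \<zeta> j \<in> {-1, 1}"
      and maximal: "maximal_particle_solution \<gamma> s N \<zeta> x0 Tc x"
      and i: "i \<in> {1..N-1}" "\<zeta> i * \<zeta> (i + 1) = -1"
      and close0: "ereal (gap x0 i) \<le> ereal a * min_other_gap N x0 i"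
    interpret close_opposite_flow \<gamma> s N \<zeta> x0 Tc x i a b
    proof
      show "\<gamma> > 0" using layer layer_gamma_pos by simp
      show "gap x0 i \<le> a * gap x0 j" if "j \<in> {1..N - 1} - {i}" for j
        using close0 that a(1) by (simp add: le_mult_min_other_gap_iff)
      show "particle_solution \<gamma> s N \<zeta> x0 Tc x" using maximal by (simp add: maximal_particle_solution_def)
      show "\<zeta> j \<in> {-1, 1}" if "j \<in> {1..N}" for j using \<zeta> that by blast
      show "\<zeta> i * \<zeta> (Suc i) = -1" using i(2) by simp
    qed fact+
    have Tc: "Tc \<noteq> \<infinity>" using lifetime_le by auto
    moreover have "0 < Tc" using maximal unfolding maximal_particle_solution_def by blast
    \<comment> \<open>Positivity and finiteness ensure that \<open>real_of_ereal Tc\<close> is the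
      actual end time and not a default value.\<close>
    ultimately have "Tc = ereal (real_of_ereal Tc)" by (cases Tc) auto
    from gap_tendsto_zero[OF maximal this] a(2)
    have "((\<lambda>t. gap (\<lambda>j. x j t) i) \<longlongrightarrow> 0) (at_left (real_of_ereal Tc))"
      by (simp add: gap_at_def[abs_def])
    moreover have "ereal (gap (\<lambda>j. x j t) i) \<le> ereal a * min_other_gap N (\<lambda>j. x j t) i"
      if "0 < t" "ereal t < Tc" for t
      using stays_close[of t] that a(1) by (simp add: le_mult_min_other_gap_iff gap_at_def)
    ultimately show "(\<forall>t. 0 < t \<and> ereal t < Tc \<longrightarrow>
           ereal (gap (\<lambda>j. x j t) i) \<le> ereal a * min_other_gap N (\<lambda>j. x j t) i) \<and>
        Tc < \<infinity> \<and>
        ((\<lambda>t. gap (\<lambda>j. x j t) i) \<longlongrightarrow> 0) (at_left (real_of_ereal Tc)) \<and>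
        Tc \<le> ereal (s * gap x0 i powr (2 * s + 1) /
               ((2 * s + 1) * \<gamma> * (1 - (real N - 2) * a powr (2 * s))))"
      using Tc lifetime_le unfolding \<kappa>_def by simp
  qed
qed

end
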